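(* Let $\alpha$ be an irrational real number and let $\beta$ be a real number. Assume that for every $\chi\in\mathrm{Sp}(\alpha,\beta)$ there is a real $\theta$ such that $H(\alpha,\beta,\theta)$ has an eigenvector with eigenvalue $\chi$ that decays exponentially as $|n|\to\infty$. Then $\mathrm{Sp}(\alpha,\beta)$ is not a Cantor set, i.e. it is not nowhere dense in $\mathbb{R}$.
   Context: For real $\alpha,\beta,\theta$, the almost Mathieu operator $H(\alpha,\beta,\theta)$ is the bounded selfadjoint operator on $\ell^2(\mathbb{Z})$ given by $$(H(\alpha,\beta,\theta)\xi)_n=\xi_{n+1}+\xi_{n-1}+2\beta\cos(2\pi\alpha n+\theta)\,\xi_n .$$ For irrational $\alpha$ its spectrum does not depend on $\theta$; this common spectrum is denoted $\mathrm{Sp}(\alpha,\beta)$. An eigenvector $\xi\in\ell^2(\mathbb{Z})$, $\xi\neq 0$, decays exponentially if there are constants $C,\gamma>0$ with $|\xi_n|\le Ce^{-\gamma|n|}$ for all $n\in\mathbb{Z}$. "Cantor spectrum" means that the spectrum is nowhere dense in $\mathbb{R}$. *)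

theory Defs
  imports "HOL-Analysis.Analysis"
begin

section \<open>The Hilbert space of square-summable bilateral sequences\<close>

definition ell2 :: "(int \<Rightarrow> complex) set" where
  "ell2 = {x. (\<lambda>n. (cmod (x n))\<^sup>2) summable_on UNIV}"

definition ell2_norm :: "(int \<Rightarrow> complex) \<Rightarrow> real" where
  "ell2_norm x = sqrt (\<Sum>\<^sub>\<infinity>n. (cmod (x n))\<^sup>2)"

text \<open>Operators are total functions on bilateral sequences; only their restriction to
  \<^const>\<open>ell2\<close> matters.\<close>

definition ell2_bounded_operator :: "((int \<Rightarrow> complex) \<Rightarrow> (int \<Rightarrow> complex)) \<Rightarrow> bool" where
  "ell2_bounded_operator T \<longleftrightarrow>
     (\<forall>x\<in>ell2. T x \<in> ell2) \<and>
     (\<forall>x\<in>ell2. \<forall>y\<in>ell2. T (\<lambda>n. x n + y n) = (\<lambda>n. T x n + T y n)) \<and>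
     (\<forall>c. \<forall>x\<in>ell2. T (\<lambda>n. c * x n) = (\<lambda>n. c * T x n)) \<and>
     (\<exists>K. \<forall>x\<in>ell2. ell2_norm (T x) \<le> K * ell2_norm x)"

text \<open>The complement of the set of \<open>z\<close> for which \<open>T - z\<close> has a two-sided inverse \<open>R\<close>
  among the bounded operators.\<close>

definition ell2_spectrum :: "((int \<Rightarrow> complex) \<Rightarrow> (int \<Rightarrow> complex)) \<Rightarrow> complex set" where
  "ell2_spectrum T = {z. \<not> (\<exists>R. ell2_bounded_operator R \<and>
     (\<forall>x\<in>ell2. R (\<lambda>n. T x n - z * x n) = x \<and> (\<lambda>n. T (R x) n - z * R x n) = x))}"

section \<open>The almost Mathieu operator\<close>

definition almost_mathieu ::
    "real \<Rightarrow> real \<Rightarrow> real \<Rightarrow> (int \<Rightarrow> complex) \<Rightarrow> (int \<Rightarrow> complex)" where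
  "almost_mathieu \<alpha> \<beta> \<theta> \<xi> =
     (\<lambda>n. \<xi> (n + 1) + \<xi> (n - 1)
        + complex_of_real (2 * \<beta> * cos (2 * pi * \<alpha> * of_int n + \<theta>)) * \<xi> n)"

lemma summable_on_shift:
  fixes f :: "int \<Rightarrow> real"
  assumes "f summable_on UNIV"
  shows "(\<lambda>n. f (n + k)) summable_on UNIV" "(\<Sum>\<^sub>\<infinity>n. f (n + k)) = (\<Sum>\<^sub>\<infinity>n. f n)"
proof -
  have b: "bij_betw (\<lambda>n. n + k) UNIV UNIV"
    by (rule bij_betwI[where g = "\<lambda>n. n - k"]) auto
  show "(\<lambda>n. f (n + k)) summable_on UNIV"
    using summable_on_reindex_bij_betw[OF b, of f] assms by simp
  show "(\<Sum>\<^sub>\<infinity>n. f (n + k)) = (\<Sum>\<^sub>\<infinity>n. f n)"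
    using infsum_reindex_bij_betw[OF b, of f] by simp
qed

lemma cmod_add3_square_le:
  "(cmod (a + b + c))\<^sup>2 \<le> 3 * ((cmod a)\<^sup>2 + (cmod b)\<^sup>2 + (cmod c)\<^sup>2)"
proof -
  have "cmod (a + b + c) \<le> cmod a + cmod b + cmod c"
    by (meson norm_triangle_ineq norm_triangle_mono order_refl)
  then have "(cmod (a + b + c))\<^sup>2 \<le> (cmod a + cmod b + cmod c)\<^sup>2"
    by (simp add: power_mono)
  also have "\<dots> \<le> 3 * ((cmod a)\<^sup>2 + (cmod b)\<^sup>2 + (cmod c)\<^sup>2)"
    using zero_le_power2[of "cmod a - cmod b"] zero_le_power2[of "cmod a - cmod c"]
      zero_le_power2[of "cmod b - cmod c"]
    by (simp add: power2_eq_square algebra_simps)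
  finally show ?thesis .
qed

lemma ell2_bounded_operator_almost_mathieu: "ell2_bounded_operator (almost_mathieu \<alpha> \<beta> \<theta>)"
proof -
  define K where "K = 3 * (2 + (2 * \<beta>)\<^sup>2)"
  have main: "almost_mathieu \<alpha> \<beta> \<theta> x \<in> ell2 \<and>
      ell2_norm (almost_mathieu \<alpha> \<beta> \<theta> x) \<le> sqrt K * ell2_norm x"
    if x: "x \<in> ell2" for x
  proof -
    define f where "f = (\<lambda>n. (cmod (x n))\<^sup>2)"
    have f: "f summable_on UNIV"
      using x by (simp add: ell2_def f_def)
    have f': "(\<lambda>n. f (n - 1)) summable_on UNIV" "(\<Sum>\<^sub>\<infinity>n. f (n - 1)) = (\<Sum>\<^sub>\<infinity>n. f n)"
      using summable_on_shift[OF f, of "-1"] by simp_all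
    define g where "g = (\<lambda>n. 3 * (f (n + 1) + f (n - 1) + (2 * \<beta>)\<^sup>2 * f n))"
    have fs: "(\<lambda>n. f (n + 1) + f (n - 1)) summable_on UNIV"
      by (intro summable_on_add summable_on_shift f f')
    have fc: "(\<lambda>n. (2 * \<beta>)\<^sup>2 * f n) summable_on UNIV"
      by (intro summable_on_cmult_right f)
    have g: "g summable_on UNIV"
      unfolding g_def by (intro summable_on_cmult_right summable_on_add fs fc)
    have "infsum g UNIV = 3 * (\<Sum>\<^sub>\<infinity>n. f (n + 1) + f (n - 1) + (2 * \<beta>)\<^sup>2 * f n)"
      unfolding g_def by (rule infsum_cmult_right')
    also have "(\<Sum>\<^sub>\<infinity>n. f (n + 1) + f (n - 1) + (2 * \<beta>)\<^sup>2 * f n)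
        = (\<Sum>\<^sub>\<infinity>n. f (n + 1) + f (n - 1)) + (\<Sum>\<^sub>\<infinity>n. (2 * \<beta>)\<^sup>2 * f n)"
      by (rule infsum_add[OF fs fc])
    also have "(\<Sum>\<^sub>\<infinity>n. f (n + 1) + f (n - 1)) = (\<Sum>\<^sub>\<infinity>n. f (n + 1)) + (\<Sum>\<^sub>\<infinity>n. f (n - 1))"
      by (rule infsum_add[OF summable_on_shift(1)[OF f] f'(1)])
    also have "(\<Sum>\<^sub>\<infinity>n. (2 * \<beta>)\<^sup>2 * f n) = (2 * \<beta>)\<^sup>2 * infsum f UNIV"
      by (rule infsum_cmult_right')
    finally have g_sum: "infsum g UNIV = K * infsum f UNIV"
      unfolding summable_on_shift(2)[OF f] f'(2) K_def by (simp add: algebra_simps)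
    have le: "(cmod (almost_mathieu \<alpha> \<beta> \<theta> x n))\<^sup>2 \<le> g n" for n
    proof -
      define v where "v = 2 * \<beta> * cos (2 * pi * \<alpha> * of_int n + \<theta>)"
      have "\<bar>v\<bar> \<le> \<bar>2 * \<beta>\<bar>"
        using mult_left_mono[OF abs_cos_le_one, of "\<bar>2 * \<beta>\<bar>"]
        by (simp add: v_def abs_mult)
      then have "v\<^sup>2 \<le> (2 * \<beta>)\<^sup>2"
        by (simp add: abs_le_square_iff)
      then have "v\<^sup>2 * f n \<le> (2 * \<beta>)\<^sup>2 * f n"
        by (intro mult_right_mono) (auto simp: f_def)
      moreover have "(cmod (almost_mathieu \<alpha> \<beta> \<theta> x n))\<^sup>2
          \<le> 3 * (f (n + 1) + f (n - 1) + v\<^sup>2 * f n)"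
        using cmod_add3_square_le[of "x (n + 1)" "x (n - 1)" "complex_of_real v * x n"]
        by (simp add: almost_mathieu_def v_def f_def norm_mult power_mult_distrib)
      ultimately show ?thesis
        by (simp add: g_def)
    qed
    have s: "(\<lambda>n. (cmod (almost_mathieu \<alpha> \<beta> \<theta> x n))\<^sup>2) summable_on UNIV"
      by (rule summable_on_comparison_test[OF g]) (use le in auto)
    have "(\<Sum>\<^sub>\<infinity>n. (cmod (almost_mathieu \<alpha> \<beta> \<theta> x n))\<^sup>2) \<le> K * infsum f UNIV"
      using infsum_mono[OF s g] le g_sum by simp
    then have "ell2_norm (almost_mathieu \<alpha> \<beta> \<theta> x) \<le> sqrt (K * infsum f UNIV)"
      by (simp add: ell2_norm_def)
    then show ?thesis
      using s by (simp add: ell2_def ell2_norm_def real_sqrt_mult f_def)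
  qed
  show ?thesis
    unfolding ell2_bounded_operator_def
  proof (intro conjI)
    show "\<exists>K. \<forall>x\<in>ell2. ell2_norm (almost_mathieu \<alpha> \<beta> \<theta> x) \<le> K * ell2_norm x"
      using main by blast
  qed (use main in \<open>auto simp: almost_mathieu_def algebra_simps\<close>)
qed

text \<open>The spectrum at phase \<open>0\<close>: for irrational \<open>\<alpha>\<close> the spectrum is the same for every phase.
  The operator is selfadjoint, so its spectrum consists of real numbers and is taken as a subset
  of \<open>\<real>\<close>, the space in which density is discussed.\<close>

definition Sp :: "real \<Rightarrow> real \<Rightarrow> real set" where
  "Sp \<alpha> \<beta> = {E. complex_of_real E \<in> ell2_spectrum (almost_mathieu \<alpha> \<beta> 0)}"

definition ell2_eigenvector ::
    "((int \<Rightarrow> complex) \<Rightarrow> (int \<Rightarrow> complex)) \<Rightarrow> complex \<Rightarrow> (int \<Rightarrow> complex) \<Rightarrow> bool" where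
  "ell2_eigenvector T z \<xi> \<longleftrightarrow> \<xi> \<in> ell2 \<and> \<xi> \<noteq> (\<lambda>n. 0) \<and> T \<xi> = (\<lambda>n. z * \<xi> n)"

definition decays_exponentially :: "(int \<Rightarrow> complex) \<Rightarrow> bool" where
  "decays_exponentially \<xi> \<longleftrightarrow>
     (\<exists>C \<gamma>. C > 0 \<and> \<gamma> > 0 \<and> (\<forall>n. cmod (\<xi> n) \<le> C * exp (- \<gamma> * \<bar>real_of_int n\<bar>)))"

definition nowhere_dense :: "'a::topological_space set \<Rightarrow> bool" where
  "nowhere_dense S \<longleftrightarrow> interior (closure S) = {}"

end

theory Submission
  imports Defs "HOL-Analysis.Kronecker_Approximation_Theorem"
begin

text \<open>Suppose the spectrum is closed with empty interior. By Baire's theorem, on some relatively open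
  piece of it all eigenvectors are, after translation, exponentially localized around \<open>0\<close> with uniform
  constants. The piece has no isolated points, so it contains infinitely many gap edges \<open>E\<close>. At a
  gap edge the derivative of \<open>\<langle>\<xi>, H(\<theta>) \<xi>\<rangle>\<close> in \<open>\<theta>\<close> vanishes; for the Aubry dual Bloch wave \<open>f(x) = \<Sum> \<xi>\<^sub>n e\<^bsup>inx\<^esup>\<close>
  this says that its Wronskian with the conjugate wave is zero, which forces the resonance
  \<open>2\<theta> \<in> 2\<pi>\<int> - 2\<pi>\<alpha>d\<close> for an integer \<open>d\<close>. Then \<open>\<xi>\<close> is symmetric about \<open>d/2\<close>, and uniform localization bounds
  \<open>d\<close>, so only finitely many phases occur. One phase therefore has infinitely many orthogonal
  eigenvectors of bounded norm with \<open>\<xi>\<^sub>0 = 1\<close>, contradicting Bessel's inequality.\<close>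

section \<open>Real square-summable sequences\<close>

text \<open>The hypothesis gives no control over the phase attached to an energy, and eigenvectors
  at different phases belong to different operators, so orthogonality says nothing about them. The
  resonance condition is what collapses the phases to finitely many. It arises because the mean of
  the Wronskian over a period is, by Parseval, the phase derivative up to a constant factor, while
  Aubry duality makes the Wronskian constant. Once it vanishes, the Bloch wave and its translate
  share a direction up to sign; the square of that direction is a continuous circle-valued function,
  and its winding number is the integer d. Spectral theory enters only through lower bounds on norms
  and inequalities between quadratic forms. This captures the approximate point spectrum, which
  translation and the density of the irrational rotation make independent of the phase. Sequences
  are real because the equation has real coefficients: real and imaginary parts of an eigenvector
  solve it separately.\<close>

typedef sq = "{x :: int \<Rightarrow> real. (\<lambda>n. (x n)\<^sup>2) summable_on UNIV}"
  morphisms coord Sq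
  by (rule exI[of _ "\<lambda>_. 0"]) simp

setup_lifting type_definition_sq

lemma summable_on_square_add:
  fixes x y :: "'i \<Rightarrow> real"
  assumes "(\<lambda>n. (x n)\<^sup>2) summable_on A" "(\<lambda>n. (y n)\<^sup>2) summable_on A"
  shows "(\<lambda>n. (x n + y n)\<^sup>2) summable_on A"
proof (rule summable_on_comparison_test)
  show "(\<lambda>n. 2 * ((x n)\<^sup>2 + (y n)\<^sup>2)) summable_on A"
    by (intro summable_on_cmult_right summable_on_add assms)
  show "(x n + y n)\<^sup>2 \<le> 2 * ((x n)\<^sup>2 + (y n)\<^sup>2)" for n
    using sum_squares_bound[of "x n" "y n"] by (simp add: power2_sum)
qed auto

lemma summable_on_square_bounded_mult:
  fixes x g :: "'i \<Rightarrow> real"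
  assumes "(\<lambda>n. (x n)\<^sup>2) summable_on A" "\<And>n. \<bar>g n\<bar> \<le> M"
  shows "(\<lambda>n. (g n * x n)\<^sup>2) summable_on A"
proof (rule summable_on_comparison_test)
  show "(\<lambda>n. M\<^sup>2 * (x n)\<^sup>2) summable_on A"
    by (intro summable_on_cmult_right assms)
  show "(g n * x n)\<^sup>2 \<le> M\<^sup>2 * (x n)\<^sup>2" for n
    using assms(2)[of n] power_mono[of "\<bar>g n\<bar>" M 2]
    by (auto simp: power_mult_distrib intro!: mult_right_mono)
qed auto

lemma summable_on_mult_of_squares:
  fixes x y :: "'i \<Rightarrow> real"
  assumes "(\<lambda>n. (x n)\<^sup>2) summable_on A" "(\<lambda>n. (y n)\<^sup>2) summable_on A"
  shows "(\<lambda>n. x n * y n) summable_on A"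
proof (rule abs_summable_summable, rule Infinite_Sum.abs_summable_on_comparison_test')
  show "(\<lambda>n. (x n)\<^sup>2 + (y n)\<^sup>2) summable_on A"
    by (intro summable_on_add assms)
  show "norm (x n * y n) \<le> (x n)\<^sup>2 + (y n)\<^sup>2" for n
  proof -
    have "0 \<le> \<bar>x n\<bar> * \<bar>y n\<bar>" by simp
    then show ?thesis
      using sum_squares_bound[of "\<bar>x n\<bar>" "\<bar>y n\<bar>"] unfolding real_norm_def abs_mult power2_abs by linarith
  qed
qed

instantiation sq :: real_vector
begin
lift_definition zero_sq :: sq is "\<lambda>_. 0" by simp
lift_definition plus_sq :: "sq \<Rightarrow> sq \<Rightarrow> sq" is "\<lambda>x y n. x n + y n"
  by (rule summable_on_square_add)
lift_definition uminus_sq :: "sq \<Rightarrow> sq" is "\<lambda>x n. - x n" by simp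
lift_definition minus_sq :: "sq \<Rightarrow> sq \<Rightarrow> sq" is "\<lambda>x y n. x n - y n"
proof -
  fix x y :: "int \<Rightarrow> real"
  assume "(\<lambda>n. (x n)\<^sup>2) summable_on UNIV" "(\<lambda>n. (y n)\<^sup>2) summable_on UNIV"
  then show "(\<lambda>n. (x n - y n)\<^sup>2) summable_on UNIV"
    using summable_on_square_add[of x UNIV "\<lambda>n. - y n"] by simp
qed
lift_definition scaleR_sq :: "real \<Rightarrow> sq \<Rightarrow> sq" is "\<lambda>c x n. c * x n"
  by (rule summable_on_square_bounded_mult[where M = "\<bar>c\<bar>" for c]) auto
instance
  by standard (transfer, simp add: algebra_simps)+
end

instantiation sq :: real_inner
begin
lift_definition inner_sq :: "sq \<Rightarrow> sq \<Rightarrow> real" is "\<lambda>x y. \<Sum>\<^sub>\<infinity>n. x n * y n" .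
definition norm_sq :: "sq \<Rightarrow> real" where "norm_sq x = sqrt (inner x x)"
definition sgn_sq :: "sq \<Rightarrow> sq" where "sgn_sq x = x /\<^sub>R norm x"
definition dist_sq :: "sq \<Rightarrow> sq \<Rightarrow> real" where "dist_sq x y = norm (x - y)"
definition uniformity_sq :: "(sq \<times> sq) filter"
  where "uniformity_sq = (INF e\<in>{0<..}. principal {(x, y). dist x y < e})"
definition open_sq :: "sq set \<Rightarrow> bool"
  where "open_sq U = (\<forall>x\<in>U. eventually (\<lambda>(x', y). x' = x \<longrightarrow> y \<in> U) uniformity)"
instance
proof
  fix x y z :: sq and r :: real
  show "dist x y = norm (x - y)" by (rule dist_sq_def)
  show "sgn x = x /\<^sub>R norm x" by (rule sgn_sq_def)
  show "uniformity = (INF e\<in>{0<..}. principal {(x :: sq, y). dist x y < e})"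
    by (rule uniformity_sq_def)
  show "open U = (\<forall>x\<in>U. eventually (\<lambda>(x', y). x' = x \<longrightarrow> y \<in> U) uniformity)" for U :: "sq set"
    by (rule open_sq_def)
  show "inner x y = inner y x" by transfer (simp add: mult.commute)
  show "inner (x + y) z = inner x z + inner y z"
    by transfer (simp add: distrib_right infsum_add summable_on_mult_of_squares)
  show "inner (r *\<^sub>R x) y = r * inner x y"
    by transfer (simp add: mult.assoc infsum_cmult_right')
  show "0 \<le> inner x x" by transfer (auto intro: infsum_nonneg)
  show "inner x x = 0 \<longleftrightarrow> x = 0"
  proof transfer
    fix x :: "int \<Rightarrow> real" assume s: "(\<lambda>n. (x n)\<^sup>2) summable_on UNIV"
    have "x n = 0" if "(\<Sum>\<^sub>\<infinity>n. x n * x n) = 0" for n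
    proof -
      have "(\<Sum>\<^sub>\<infinity>n. (x n)\<^sup>2) \<le> 0" using that by (simp only: power2_eq_square)
      from nonneg_infsum_le_0D[OF this s, of n] show ?thesis by simp
    qed
    then show "((\<Sum>\<^sub>\<infinity>n. x n * x n) = 0) = (x = (\<lambda>_. 0))"
      by (intro iffI ext) (assumption | simp)+
  qed
  show "norm x = sqrt (inner x x)" by (rule norm_sq_def)
qed
end

lemma summable_coord_square: "(\<lambda>n. (coord v n)\<^sup>2) summable_on UNIV"
  using coord[of v] by simp

lemma coord_simps [simp]:
  "coord 0 n = 0" "coord (v + w) n = coord v n + coord w n"
  "coord (- v) n = - coord v n" "coord (v - w) n = coord v n - coord w n"
  "coord (c *\<^sub>R v) n = c * coord v n"
  by (simp_all add: zero_sq.rep_eq plus_sq.rep_eq uminus_sq.rep_eq minus_sq.rep_eq scaleR_sq.rep_eq)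

lemma coord_sum [simp]: "coord (sum f A) n = (\<Sum>a\<in>A. coord (f a) n)"
  by (induction A rule: infinite_finite_induct) auto

lemma sq_eqI: "(\<And>n. coord v n = coord w n) \<Longrightarrow> v = w"
  by (metis coord_inject ext)

lemma inner_sq: "v \<bullet> w = (\<Sum>\<^sub>\<infinity>n. coord v n * coord w n)"
  by (simp add: inner_sq.rep_eq)

lemma norm_sq_square: "(norm v)\<^sup>2 = (\<Sum>\<^sub>\<infinity>n. (coord v n)\<^sup>2)" for v :: sq
  unfolding power2_norm_eq_inner inner_sq by (simp only: power2_eq_square)

lemma abs_coord_le_norm: "\<bar>coord v n\<bar> \<le> norm v"
proof -
  have "(coord v n)\<^sup>2 = (\<Sum>\<^sub>\<infinity>k\<in>{n}. (coord v k)\<^sup>2)" by simp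
  also have "\<dots> \<le> (\<Sum>\<^sub>\<infinity>k. (coord v k)\<^sup>2)"
    by (rule infsum_mono_neutral) (auto simp: summable_coord_square)
  finally have "(coord v n)\<^sup>2 \<le> (norm v)\<^sup>2" by (simp add: norm_sq_square)
  then show ?thesis by (simp add: abs_le_square_iff[symmetric])
qed

lift_definition shift :: "int \<Rightarrow> sq \<Rightarrow> sq" is "\<lambda>k x n. x (n - k)"
proof -
  fix k :: int and x :: "int \<Rightarrow> real"
  assume "(\<lambda>n. (x n)\<^sup>2) summable_on UNIV"
  from summable_on_shift(1)[OF this, of "-k"]
  show "(\<lambda>n. (x (n - k))\<^sup>2) summable_on UNIV" by simp
qed

lemma coord_shift [simp]: "coord (shift k v) n = coord v (n - k)"
  by (simp add: shift.rep_eq)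

lemma infsum_int_shift: "(\<Sum>\<^sub>\<infinity>n. f (n - k)) = (\<Sum>\<^sub>\<infinity>n. f n)" for f :: "int \<Rightarrow> real" and k :: int
  by (rule infsum_reindex_bij_betw) (rule bij_betwI[where g = "\<lambda>n. n + k"], auto)

lemma inner_shift [simp]: "shift k v \<bullet> shift k w = v \<bullet> w"
  using infsum_int_shift[of "\<lambda>n. coord v n * coord w n" k] by (simp add: inner_sq)

lemma norm_shift [simp]: "norm (shift k v) = norm v"
  by (simp add: norm_eq_sqrt_inner)

lemma shift_shift [simp]: "shift k (shift l v) = shift (k + l) v"
  by (rule sq_eqI) (simp add: algebra_simps)

lemma shift_0 [simp]: "shift 0 v = v"
  by (rule sq_eqI) simp

lemma inner_shift_left: "shift k v \<bullet> w = v \<bullet> shift (- k) w"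
  using inner_shift[of k v "shift (- k) w"] by simp

lemma shift_linear [simp]:
  "shift k (v + w) = shift k v + shift k w" "shift k (v - w) = shift k v - shift k w"
  "shift k (c *\<^sub>R v) = c *\<^sub>R shift k v"
  by (rule sq_eqI, simp)+

lift_definition cos_mult :: "real \<Rightarrow> real \<Rightarrow> sq \<Rightarrow> sq"
  is "\<lambda>\<omega> \<theta> x n. cos (\<omega> * of_int n + \<theta>) * x n"
  by (rule summable_on_square_bounded_mult[where M = 1]) auto

lemma coord_cos_mult [simp]:
  "coord (cos_mult \<omega> \<theta> v) n = cos (\<omega> * of_int n + \<theta>) * coord v n"
  by (simp add: cos_mult.rep_eq)

lemma norm_sq_le:
  assumes "\<And>n. \<bar>coord v n\<bar> \<le> M * \<bar>coord w n\<bar>" "0 \<le> M"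
  shows "norm v \<le> M * norm w"
proof -
  have *: "(coord v n)\<^sup>2 \<le> M\<^sup>2 * (coord w n)\<^sup>2" for n
    using power_mono[OF assms(1)[of n], of 2] by (simp add: power_mult_distrib)
  have "(norm v)\<^sup>2 \<le> (\<Sum>\<^sub>\<infinity>n. M\<^sup>2 * (coord w n)\<^sup>2)"
    unfolding norm_sq_square
    by (rule infsum_mono) (use * in \<open>auto intro!: summable_on_cmult_right summable_coord_square\<close>)
  also have "\<dots> = (M * norm w)\<^sup>2"
    by (simp add: power_mult_distrib norm_sq_square infsum_cmult_right')
  finally show ?thesis
    by (rule power2_le_imp_le) (use assms(2) in simp)
qed

section \<open>The real almost Mathieu operator and its phase symmetries\<close>

definition mathieu :: "real \<Rightarrow> real \<Rightarrow> real \<Rightarrow> sq \<Rightarrow> sq" where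
  "mathieu \<alpha> \<beta> \<theta> v = shift (-1) v + shift 1 v + (2 * \<beta>) *\<^sub>R cos_mult (2 * pi * \<alpha>) \<theta> v"

lemma coord_mathieu:
  "coord (mathieu \<alpha> \<beta> \<theta> v) n =
     coord v (n + 1) + coord v (n - 1) + 2 * \<beta> * cos (2 * pi * \<alpha> * of_int n + \<theta>) * coord v n"
  by (simp add: mathieu_def)

lemma inner_cos_mult: "cos_mult \<omega> \<theta> v \<bullet> w = v \<bullet> cos_mult \<omega> \<theta> w"
  by (simp add: inner_sq algebra_simps)

lemma linear_mathieu: "linear (mathieu \<alpha> \<beta> \<theta>)"
  by (rule linearI; rule sq_eqI) (simp_all add: coord_mathieu algebra_simps)

lemma mathieu_symmetric: "mathieu \<alpha> \<beta> \<theta> v \<bullet> w = v \<bullet> mathieu \<alpha> \<beta> \<theta> w"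
  by (simp add: mathieu_def inner_add inner_shift_left inner_cos_mult)

lemma norm_cos_mult_diff: "norm (cos_mult \<omega> \<theta> v - cos_mult \<omega> \<theta>' v) \<le> \<bar>\<theta> - \<theta>'\<bar> * norm v"
proof (rule norm_sq_le)
  have "\<bar>cos a - cos b\<bar> \<le> \<bar>a - b\<bar>" for a b :: real
  proof -
    have "\<bar>cos a - cos b\<bar> = 2 * \<bar>sin ((a + b) / 2)\<bar> * \<bar>sin ((b - a) / 2)\<bar>"
      by (simp add: cos_diff_cos abs_mult)
    also have "\<dots> \<le> 2 * 1 * \<bar>(b - a) / 2\<bar>"
      by (intro mult_mono abs_sin_x_le_abs_x) auto
    finally show ?thesis by simp
  qed
  note * = this
  show "\<bar>coord (cos_mult \<omega> \<theta> v - cos_mult \<omega> \<theta>' v) n\<bar> \<le> \<bar>\<theta> - \<theta>'\<bar> * \<bar>coord v n\<bar>" for n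
  proof -
    let ?a = "\<omega> * of_int n + \<theta>" and ?b = "\<omega> * of_int n + \<theta>'"
    have "coord (cos_mult \<omega> \<theta> v - cos_mult \<omega> \<theta>' v) n = (cos ?a - cos ?b) * coord v n"
      by (simp only: coord_simps coord_cos_mult left_diff_distrib)
    then show ?thesis
      using mult_right_mono[OF *[of ?a ?b], of "\<bar>coord v n\<bar>"] by (simp add: abs_mult)
  qed
qed auto

lemma mathieu_diff:
  "mathieu \<alpha> \<beta> \<theta> v - mathieu \<alpha> \<beta> \<theta>' v =
     (2 * \<beta>) *\<^sub>R (cos_mult (2 * pi * \<alpha>) \<theta> v - cos_mult (2 * pi * \<alpha>) \<theta>' v)"
  by (simp add: mathieu_def algebra_simps)

lemma norm_mathieu_diff:
  "norm (mathieu \<alpha> \<beta> \<theta> v - mathieu \<alpha> \<beta> \<theta>' v) \<le> 2 * \<bar>\<beta>\<bar> * \<bar>\<theta> - \<theta>'\<bar> * norm v"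
  using mult_left_mono[OF norm_cos_mult_diff[of "2 * pi * \<alpha>" \<theta> v \<theta>'], of "2 * \<bar>\<beta>\<bar>"]
  by (simp add: mathieu_diff abs_mult mult.assoc)

lemma norm_mathieu_le: "norm (mathieu \<alpha> \<beta> \<theta> v) \<le> (2 + 2 * \<bar>\<beta>\<bar>) * norm v"
proof -
  have "norm (cos_mult (2 * pi * \<alpha>) \<theta> v) \<le> 1 * norm v"
    by (rule norm_sq_le) (simp_all add: abs_mult mult_left_le_one_le)
  then have "norm ((2 * \<beta>) *\<^sub>R cos_mult (2 * pi * \<alpha>) \<theta> v) \<le> 2 * \<bar>\<beta>\<bar> * norm v"
    by (simp add: abs_mult mult_left_mono)
  moreover have "norm (shift (-1) v + shift 1 v) \<le> norm v + norm v"
    by (metis norm_shift norm_triangle_ineq)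
  ultimately show ?thesis
    unfolding mathieu_def
    using norm_triangle_ineq[of "shift (-1) v + shift 1 v" "(2 * \<beta>) *\<^sub>R cos_mult (2 * pi * \<alpha>) \<theta> v"]
    by (simp add: algebra_simps)
qed

text \<open>Translation moves the potential along an orbit of the rotation. Together with
  \<open>mathieu_periodic\<close> this makes every phase reachable from every other up to an
  arbitrarily small error, the source of phase independence.\<close>

lemma mathieu_shift: "mathieu \<alpha> \<beta> \<theta> (shift k v) = shift k (mathieu \<alpha> \<beta> (\<theta> + 2 * pi * \<alpha> * of_int k) v)"
  by (rule sq_eqI) (simp add: coord_mathieu algebra_simps)

lemma mathieu_periodic: "mathieu \<alpha> \<beta> (\<theta> + 2 * pi * of_int j) v = mathieu \<alpha> \<beta> \<theta> v"
proof (rule sq_eqI)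
  have "cos (x + (\<theta> + 2 * pi * of_int j)) = cos (x + \<theta>)" for x
    using cos.plus_of_int[of "x + \<theta>" j] by (simp add: algebra_simps)
  then show "coord (mathieu \<alpha> \<beta> (\<theta> + 2 * pi * of_int j) v) n = coord (mathieu \<alpha> \<beta> \<theta> v) n" for n
    by (simp add: coord_mathieu)
qed

section \<open>Spectral gaps of symmetric operators\<close>

text \<open>For a bounded selfadjoint operator on a Hilbert space this is equivalent to
  invertibility, so it stands in for membership in the resolvent set without constructing an
  inverse.\<close>

definition bounded_below :: "('a::real_inner \<Rightarrow> 'a) \<Rightarrow> bool" where
  "bounded_below T \<longleftrightarrow> (\<exists>m>0. \<forall>v. m * norm v \<le> norm (T v))"

lemma bounded_below_comp:
  assumes "bounded_below S" "bounded_below T" "\<And>v. P v = S (T v)"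
  shows "bounded_below P"
proof -
  obtain m n where m: "m > 0" "\<And>v. m * norm v \<le> norm (S v)"
    and n: "n > 0" "\<And>v. n * norm v \<le> norm (T v)"
    using assms(1,2) by (auto simp: bounded_below_def)
  have "m * n * norm v \<le> norm (P v)" for v
    using order.trans[OF mult_left_mono[OF n(2)[of v], of m] m(2)[of "T v"]] m(1) assms(3)
    by (simp add: mult.assoc)
  then show ?thesis
    using m(1) n(1) by (auto simp: bounded_below_def intro!: exI[of _ "m * n"])
qed

locale symmetric_operator =
  fixes T :: "'a::real_inner \<Rightarrow> 'a" and K :: real
  assumes lin: "linear T"
    and sym: "\<And>v w. T v \<bullet> w = v \<bullet> T w"
    and bound: "\<And>v. norm (T v) \<le> K * norm v"
    and K_pos: "K > 0"
begin

lemmas lin_simps = linear_add[OF lin] linear_diff[OF lin] linear_scale[OF lin]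

lemma symmetric_operator_shifted: "symmetric_operator (\<lambda>v. T v - c *\<^sub>R v) (K + \<bar>c\<bar>)"
proof (rule symmetric_operator.intro)
  show "linear (\<lambda>v. T v - c *\<^sub>R v)"
    by (rule linearI) (simp_all add: lin_simps algebra_simps)
  show "(T v - c *\<^sub>R v) \<bullet> w = v \<bullet> (T w - c *\<^sub>R w)" for v w
    by (simp add: inner_diff sym)
  show "norm (T v - c *\<^sub>R v) \<le> (K + \<bar>c\<bar>) * norm v" for v
    using norm_triangle_ineq4[of "T v" "c *\<^sub>R v"] bound[of v] by (simp add: algebra_simps)
  show "K + \<bar>c\<bar> > 0" using K_pos by simp
qed

lemma symmetric_operator_square: "symmetric_operator (\<lambda>v. T (T v)) (K * K)"
proof (rule symmetric_operator.intro)
  show "linear (\<lambda>v. T (T v))"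
    by (rule linearI) (simp_all add: lin_simps)
  show "T (T v) \<bullet> w = v \<bullet> T (T w)" for v w
    by (simp add: sym)
  show "norm (T (T v)) \<le> K * K * norm v" for v
    using order.trans[OF bound[of "T v"] mult_left_mono[OF bound[of v], of K]] K_pos
    by (simp add: mult.assoc)
  show "K * K > 0" using K_pos by simp
qed

text \<open>Positivity is tested on the vector reached from \<open>v\<close> by a gradient step of
  length \<open>1 / K\<close>. The result converts a lower bound on \<open>norm (T v)\<close> into
  one on the quadratic form.\<close>

lemma norm_square_le_form:
  assumes "\<And>v. 0 \<le> v \<bullet> T v"
  shows "(norm (T v))\<^sup>2 \<le> K * (v \<bullet> T v)"
proof -
  define t where "t = 1 / K"
  define w where "w = v - t *\<^sub>R T v"
  have "v \<bullet> T (T v) = (norm (T v))\<^sup>2"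
    by (simp add: sym[symmetric] power2_norm_eq_inner)
  moreover have "w \<bullet> T w = v \<bullet> T v - t * (v \<bullet> T (T v)) - t * (T v \<bullet> T v) + t\<^sup>2 * (T v \<bullet> T (T v))"
    by (simp add: w_def lin_simps inner_diff_left inner_diff_right power2_eq_square algebra_simps)
  ultimately have "w \<bullet> T w = v \<bullet> T v - 2 / K * (norm (T v))\<^sup>2 + (1 / K)\<^sup>2 * (T v \<bullet> T (T v))"
    by (simp add: t_def power2_norm_eq_inner)
  also have "T v \<bullet> T (T v) \<le> norm (T v) * (K * norm (T v))"
    by (rule order.trans[OF norm_cauchy_schwarz]) (intro mult_left_mono bound norm_ge_zero)
  finally have "w \<bullet> T w \<le> v \<bullet> T v - 2 / K * (norm (T v))\<^sup>2
      + (1 / K)\<^sup>2 * (norm (T v) * (K * norm (T v)))"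
    by (simp add: mult_left_mono)
  also have "\<dots> = v \<bullet> T v - (norm (T v))\<^sup>2 / K"
    using K_pos by (simp add: field_simps power2_eq_square)
  finally have "(norm (T v))\<^sup>2 / K \<le> v \<bullet> T v"
    using assms[of w] by linarith
  then show ?thesis
    using K_pos by (simp add: field_simps)
qed

text \<open>If \<open>m = inf \<parallel>T v\<parallel>\<close> over unit vectors, then \<open>T\<^sup>2 - m\<^sup>2\<close> is a positive form with infimum \<open>0\<close>,
  hence not bounded below, and one of its factors \<open>T - m\<close>, \<open>T + m\<close> is not bounded below either.\<close>

lemma norm_ge_of_spectral_gap:
  assumes r: "\<And>c. \<bar>c\<bar> < r \<Longrightarrow> bounded_below (\<lambda>v. T v - c *\<^sub>R v)"
  shows "r * norm v \<le> norm (T v)"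
proof (rule ccontr)
  assume neg: "\<not> r * norm v \<le> norm (T v)"
  define S where "S = (\<lambda>v. norm (T v)) ` {v. norm v = 1}"
  define m where "m = Inf S"
  have bdd: "bdd_below S" by (auto simp: S_def intro!: bdd_belowI[of _ 0])
  have "v \<noteq> 0" using neg by auto
  define u where "u = v /\<^sub>R norm v"
  have u: "norm u = 1" "norm (T u) < r"
    using neg \<open>v \<noteq> 0\<close> by (auto simp: u_def lin_simps field_simps)
  have "m \<ge> 0" unfolding m_def by (rule cInf_greatest) (use u in \<open>auto simp: S_def\<close>)
  have "m < r" using cInf_lower[of "norm (T u)" S] bdd u by (auto simp: m_def S_def)
  have m_le: "m * norm w \<le> norm (T w)" for w
  proof (cases "w = 0")
    case False
    have "norm (T (w /\<^sub>R norm w)) \<in> S" using False by (auto simp: S_def)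
    then have "m \<le> norm (T (w /\<^sub>R norm w))" unfolding m_def by (rule cInf_lower) (rule bdd)
    then show ?thesis using False by (simp add: lin_simps field_simps)
  qed simp
  define P where "P = (\<lambda>v. T (T v) - m\<^sup>2 *\<^sub>R v)"
  interpret P: symmetric_operator P "K * K + \<bar>m\<^sup>2\<bar>"
    unfolding P_def
    by (rule symmetric_operator.symmetric_operator_shifted[OF symmetric_operator_square])
  have form: "w \<bullet> P w = (norm (T w))\<^sup>2 - m\<^sup>2 * (norm w)\<^sup>2" for w
    by (simp add: P_def inner_diff sym[symmetric] power2_norm_eq_inner)
  have pos: "0 \<le> w \<bullet> P w" for w
    using power_mono[OF m_le[of w], of 2] \<open>m \<ge> 0\<close> by (simp add: form power_mult_distrib)
  have "bounded_below P"
  proof (rule bounded_below_comp)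
    show "bounded_below (\<lambda>v. T v - m *\<^sub>R v)" using r[of m] \<open>m \<ge> 0\<close> \<open>m < r\<close> by simp
    show "bounded_below (\<lambda>v. T v - (- m) *\<^sub>R v)" using r[of "- m"] \<open>m \<ge> 0\<close> \<open>m < r\<close> by simp
    show "P v = T (T v - (- m) *\<^sub>R v) - m *\<^sub>R (T v - (- m) *\<^sub>R v)" for v
      by (simp add: P_def lin_simps algebra_simps power2_eq_square)
  qed
  then obtain d where d: "d > 0" "\<And>w. d * norm w \<le> norm (P w)"
    by (auto simp: bounded_below_def)
  \<comment> \<open>\<open>e\<close> is the gain supplied by \<open>norm_square_le_form\<close>: on
    unit vectors the square of \<open>norm (T w)\<close> is at least \<open>m\<^sup>2 + e\<close>,
    against the choice of \<open>m\<close> as an infimum.\<close>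
  define e where "e = d\<^sup>2 / (K * K + \<bar>m\<^sup>2\<bar>)"
  have "e > 0" unfolding e_def using d(1) P.K_pos by simp
  have "sqrt (m\<^sup>2 + e) \<le> norm (T w)" if "norm w = 1" for w
  proof -
    have "d\<^sup>2 \<le> (norm (P w))\<^sup>2" using d(2)[of w] d(1) that by (simp add: power_mono)
    also have "\<dots> \<le> (K * K + \<bar>m\<^sup>2\<bar>) * (w \<bullet> P w)" by (rule P.norm_square_le_form[OF pos])
    finally have "e \<le> (norm (T w))\<^sup>2 - m\<^sup>2"
      using P.K_pos that by (simp add: e_def form field_simps)
    then show ?thesis by (intro real_le_lsqrt) auto
  qed
  then have "sqrt (m\<^sup>2 + e) \<le> m"
    unfolding m_def by (intro cInf_greatest) (use u in \<open>auto simp: S_def m_def[symmetric]\<close>)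
  then have "m\<^sup>2 + e \<le> m\<^sup>2"
    using \<open>m \<ge> 0\<close> by (metis real_sqrt_le_iff real_sqrt_abs abs_of_nonneg)
  then show False using \<open>e > 0\<close> by simp
qed

text \<open>Otherwise there would be a spectral gap of radius \<open>K + 1\<close> around 0, which
  the norm bound \<open>K\<close> excludes. This makes the spectrum nonempty, as Baire's theorem
  requires later.\<close>

lemma not_all_bounded_below:
  fixes v :: 'a
  assumes "v \<noteq> 0"
  shows "\<exists>c. \<not> bounded_below (\<lambda>v. T v - c *\<^sub>R v)"
proof (rule ccontr)
  assume "\<not> ?thesis"
  then have "(K + 1) * norm v \<le> norm (T v)" by (intro norm_ge_of_spectral_gap) auto
  also have "\<dots> \<le> K * norm v" by (rule bound)
  finally show False using assms by (simp add: algebra_simps)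
qed

text \<open>With midpoint \<open>c\<close> and half-length \<open>r\<close> of the gap, the form is
  that of the square of \<open>T - c\<close> minus \<open>r\<^sup>2\<close>, and
  \<open>norm_ge_of_spectral_gap\<close> applies to \<open>T - c\<close>. It is the operator version
  of (x - a)(x - b) being nonnegative off the interval (a, b).\<close>

lemma form_nonneg_of_spectral_gap:
  assumes "a \<le> b" and gap: "\<And>c. a < c \<Longrightarrow> c < b \<Longrightarrow> bounded_below (\<lambda>v. T v - c *\<^sub>R v)"
  shows "0 \<le> (T v - a *\<^sub>R v) \<bullet> (T v - b *\<^sub>R v)"
proof -
  define c where "c = (a + b) / 2"
  define r where "r = (b - a) / 2"
  interpret S: symmetric_operator "\<lambda>v. T v - c *\<^sub>R v" "K + \<bar>c\<bar>"
    by (rule symmetric_operator_shifted)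
  have "r * norm v \<le> norm (T v - c *\<^sub>R v)"
  proof (rule S.norm_ge_of_spectral_gap)
    fix e assume "\<bar>e\<bar> < r"
    then have "a < c + e" "c + e < b" by (auto simp: c_def r_def field_simps)
    from gap[OF this] show "bounded_below (\<lambda>v. T v - c *\<^sub>R v - e *\<^sub>R v)"
      by (simp add: algebra_simps)
  qed
  then have "(r * norm v)\<^sup>2 \<le> (norm (T v - c *\<^sub>R v))\<^sup>2"
    by (rule power_mono) (use assms(1) in \<open>simp add: r_def\<close>)
  then have "r\<^sup>2 * (norm v)\<^sup>2 \<le> (norm (T v - c *\<^sub>R v))\<^sup>2"
    by (simp add: power_mult_distrib)
  moreover have "(T v - a *\<^sub>R v) \<bullet> (T v - b *\<^sub>R v)
      = (norm (T v - c *\<^sub>R v))\<^sup>2 - r\<^sup>2 * (norm v)\<^sup>2"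
  proof -
    have eq: "(x + y) \<bullet> (x - y) = (norm x)\<^sup>2 - (norm y)\<^sup>2" for x y :: 'a
      by (simp add: power2_norm_eq_inner inner_simps inner_commute)
    have "T v - a *\<^sub>R v = (T v - c *\<^sub>R v) + r *\<^sub>R v" "T v - b *\<^sub>R v = (T v - c *\<^sub>R v) - r *\<^sub>R v"
      by (simp_all add: c_def r_def algebra_simps scaleR_left_distrib[symmetric] field_simps)
    then show ?thesis
      by (simp only: eq) (simp add: power_mult_distrib)
  qed
  ultimately show ?thesis by linarith
qed

text \<open>Since the square of \<open>T\<close> minus \<open>c\<close> factors through the two
  square roots of \<open>c\<close>, the square of \<open>T\<close> has the gap from 0 to
  \<open>e\<^sup>2\<close>, and the gap form gives the estimate. It says that \<open>T\<close> is
  bounded below by \<open>e\<close> on its own range, even if it has a kernel.\<close>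

lemma norm_square_ge_of_isolated_zero:
  assumes "e > 0" and gap: "\<And>c. c \<noteq> 0 \<Longrightarrow> \<bar>c\<bar> < e \<Longrightarrow> bounded_below (\<lambda>v. T v - c *\<^sub>R v)"
  shows "e * norm (T v) \<le> norm (T (T v))"
proof -
  interpret S: symmetric_operator "\<lambda>v. T (T v)" "K * K"
    by (rule symmetric_operator_square)
  have "0 \<le> (T (T v) - 0 *\<^sub>R v) \<bullet> (T (T v) - e\<^sup>2 *\<^sub>R v)"
  proof (rule S.form_nonneg_of_spectral_gap)
    fix c assume c: "0 < c" "c < e\<^sup>2"
    have sc: "0 < sqrt c" "sqrt c < e" using c assms(1) by (auto intro: real_less_lsqrt)
    show "bounded_below (\<lambda>v. T (T v) - c *\<^sub>R v)"
    proof (rule bounded_below_comp)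
      show "bounded_below (\<lambda>v. T v - sqrt c *\<^sub>R v)" using gap[of "sqrt c"] sc by simp
      show "bounded_below (\<lambda>v. T v - (- sqrt c) *\<^sub>R v)" using gap[of "- sqrt c"] sc by simp
      have "c = sqrt c * sqrt c" using c by simp
      then show "T (T v) - c *\<^sub>R v = T (T v - (- sqrt c) *\<^sub>R v) - sqrt c *\<^sub>R (T v - (- sqrt c) *\<^sub>R v)" for v
        by (simp add: lin_simps algebra_simps)
    qed
  qed simp
  moreover have "T (T v) \<bullet> v = T v \<bullet> T v" by (rule sym)
  ultimately have "(e * norm (T v))\<^sup>2 \<le> (norm (T (T v)))\<^sup>2"
    by (simp add: inner_diff_right power2_norm_eq_inner power_mult_distrib)
  then show ?thesis by (rule power2_le_imp_le) simp
qed

text \<open>Gradient descent for the square of \<open>norm (T v)\<close>, in place of the orthogonal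
  projection onto the kernel. The lower bound on the range of \<open>T\<close> makes the residual
  \<open>T (s k)\<close> contract by \<open>q\<close>, so the increments are geometrically summable.
  The limit is taken coordinatewise, in \<open>exists_solution_near\<close>.\<close>

lemma kernel_iteration:
  assumes e: "e > 0" and ge: "\<And>v. e * norm (T v) \<le> norm (T (T v))"
  obtains q where "0 \<le> q" "q < 1"
    and "\<And>v. \<exists>s. s 0 = v \<and> (\<forall>k. norm (s (Suc k) - s k) \<le> q ^ k * norm (T v) / K \<and>
           norm (T (s k)) \<le> q ^ k * norm (T v))"
proof
  \<comment> \<open>The \<open>max\<close> covers the degenerate case \<open>T = 0\<close>, where
    \<open>e\<close> may exceed \<open>K\<close>.\<close>
  define q where "q = sqrt (max 0 (1 - e\<^sup>2 / K\<^sup>2))"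
  show "0 \<le> q" "q < 1" using e K_pos by (auto simp: q_def)
  fix v
  define s where "s = (\<lambda>k. ((\<lambda>v. v - (1 / K\<^sup>2) *\<^sub>R T (T v)) ^^ k) v)"
  have s: "s 0 = v" "\<And>k. s (Suc k) = s k - (1 / K\<^sup>2) *\<^sub>R T (T (s k))"
    by (auto simp: s_def)
  have step: "norm (T (w - (1 / K\<^sup>2) *\<^sub>R T (T w))) \<le> q * norm (T w)" for w
  proof -
    have a: "(norm (T (T (T w))))\<^sup>2 \<le> K\<^sup>2 * (norm (T (T w)))\<^sup>2"
      using power_mono[OF bound[of "T (T w)"], of 2] by (simp add: power_mult_distrib)
    have b: "e\<^sup>2 * (norm (T w))\<^sup>2 \<le> (norm (T (T w)))\<^sup>2"
      using power_mono[OF ge[of w], of 2] e by (simp add: power_mult_distrib)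
    have "(norm (T (w - (1 / K\<^sup>2) *\<^sub>R T (T w))))\<^sup>2
        = (norm (T w))\<^sup>2 - 2 / K\<^sup>2 * (norm (T (T w)))\<^sup>2 + (1 / K\<^sup>2)\<^sup>2 * (norm (T (T (T w))))\<^sup>2"
    proof -
      have *: "T w \<bullet> T (T (T w)) = T (T w) \<bullet> T (T w)" by (rule sym[symmetric])
      have "(norm (T w - t *\<^sub>R T (T (T w))))\<^sup>2
          = T w \<bullet> T w - 2 * t * (T w \<bullet> T (T (T w))) + t\<^sup>2 * (T (T (T w)) \<bullet> T (T (T w)))" for t
        unfolding power2_norm_eq_inner
        by (simp add: inner_diff_left inner_diff_right inner_commute power2_eq_square algebra_simps)
      from this[of "1 / K\<^sup>2"] show ?thesis
        by (simp add: lin_simps * power2_norm_eq_inner)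
    qed
    also have "\<dots> \<le> (norm (T w))\<^sup>2 - 2 / K\<^sup>2 * (norm (T (T w)))\<^sup>2
        + (1 / K\<^sup>2)\<^sup>2 * (K\<^sup>2 * (norm (T (T w)))\<^sup>2)"
      using mult_left_mono[OF a, of "(1 / K\<^sup>2)\<^sup>2"] by simp
    also have "\<dots> = (norm (T w))\<^sup>2 - (norm (T (T w)))\<^sup>2 / K\<^sup>2"
      using K_pos by (simp add: field_simps power2_eq_square)
    also have "\<dots> \<le> (norm (T w))\<^sup>2 - (e\<^sup>2 * (norm (T w))\<^sup>2) / K\<^sup>2"
      by (intro diff_left_mono divide_right_mono b) simp
    also have "\<dots> = (1 - e\<^sup>2 / K\<^sup>2) * (norm (T w))\<^sup>2"
      by (simp add: algebra_simps)
    also have "\<dots> \<le> q\<^sup>2 * (norm (T w))\<^sup>2"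
      by (intro mult_right_mono) (simp_all add: q_def)
    also have "\<dots> = (q * norm (T w))\<^sup>2" by (simp add: power_mult_distrib)
    finally show ?thesis by (rule power2_le_imp_le) (use \<open>0 \<le> q\<close> in simp)
  qed
  have Ts: "norm (T (s k)) \<le> q ^ k * norm (T v)" for k
  proof (induction k)
    case (Suc k)
    have "norm (T (s (Suc k))) \<le> q * norm (T (s k))" unfolding s by (rule step)
    also have "\<dots> \<le> q * (q ^ k * norm (T v))" by (intro mult_left_mono Suc \<open>0 \<le> q\<close>)
    finally show ?case by simp
  qed (simp add: s)
  have "norm (s (Suc k) - s k) \<le> q ^ k * norm (T v) / K" for k
  proof -
    have "norm (s (Suc k) - s k) = norm (T (T (s k))) / K\<^sup>2" by (simp add: s divide_inverse mult.commute)
    also have "\<dots> \<le> (K * norm (T (s k))) / K\<^sup>2" by (intro divide_right_mono bound) simp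
    also have "\<dots> = norm (T (s k)) / K" using K_pos by (simp add: power2_eq_square)
    also have "\<dots> \<le> q ^ k * norm (T v) / K" by (intro divide_right_mono Ts) (use K_pos in simp)
    finally show ?thesis .
  qed
  with s(1) Ts show "\<exists>s. s 0 = v \<and> (\<forall>k. norm (s (Suc k) - s k) \<le> q ^ k * norm (T v) / K \<and>
           norm (T (s k)) \<le> q ^ k * norm (T v))" by blast
qed

end

lemma mathieu_symmetric_operator: "symmetric_operator (mathieu \<alpha> \<beta> \<theta>) (2 + 2 * \<bar>\<beta>\<bar>)"
  by (rule symmetric_operator.intro) (simp_all add: linear_mathieu mathieu_symmetric norm_mathieu_le)

section \<open>The approximate point spectrum\<close>

lemma dense_rotation:
  fixes \<alpha> :: real
  assumes "\<alpha> \<notin> \<rat>" "\<epsilon> > 0"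
  obtains k j :: int where "\<bar>2 * pi * \<alpha> * of_int k + 2 * pi * of_int j - x\<bar> < \<epsilon>"
proof -
  obtain h k where "\<bar>of_int k * \<alpha> - of_int h - x / (2 * pi)\<bar> < \<epsilon> / (2 * pi)"
    by (rule sequence_of_fractional_parts_is_dense[OF assms(1), of "\<epsilon> / (2 * pi)" "x / (2 * pi)"])
      (use assms(2) in auto)
  then have "2 * pi * \<bar>of_int k * \<alpha> - of_int h - x / (2 * pi)\<bar> < \<epsilon>"
    by (simp add: field_simps)
  also have "2 * pi * \<bar>of_int k * \<alpha> - of_int h - x / (2 * pi)\<bar>
      = \<bar>2 * pi * (of_int k * \<alpha> - of_int h - x / (2 * pi))\<bar>"
    by (simp add: abs_mult)
  also have "2 * pi * (of_int k * \<alpha> - of_int h - x / (2 * pi))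
      = 2 * pi * \<alpha> * of_int k + 2 * pi * of_int (- h) - x"
    by (simp add: field_simps)
  finally show ?thesis by (rule that)
qed

text \<open>The approximate point spectrum, at phase 0 as in \<open>Sp\<close>. It lies in
  \<open>Sp\<close> by \<open>ap_spec_subset_Sp\<close>; equality is obtained in
  \<open>theorem2\<close>, where the hypothesis turns every point of \<open>Sp\<close> into an
  eigenvalue.\<close>

definition ap_spec :: "real \<Rightarrow> real \<Rightarrow> real set" where
  "ap_spec \<alpha> \<beta> = {E. \<not> bounded_below (\<lambda>v. mathieu \<alpha> \<beta> 0 v - E *\<^sub>R v)}"

lemma mathieu_lower_bound_shift:
  assumes "\<And>v. m * norm v \<le> norm (mathieu \<alpha> \<beta> \<theta> v - E *\<^sub>R v)"
  shows "m * norm v \<le> norm (mathieu \<alpha> \<beta> (\<theta> + 2 * pi * \<alpha> * of_int k) v - E *\<^sub>R v)"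
  using assms[of "shift k v"] by (simp add: mathieu_shift flip: shift_linear)

text \<open>Covariance carries the bound, with the same constant \<open>m\<close>, to a set of
  phases dense modulo 2 pi. For a fixed \<open>v\<close> the operator is Lipschitz in the phase, so
  the bound passes to the limit.\<close>

lemma mathieu_lower_bound_phase:
  assumes "\<alpha> \<notin> \<rat>" and m: "\<And>v. m * norm v \<le> norm (mathieu \<alpha> \<beta> \<theta> v - E *\<^sub>R v)"
  shows "m * norm v \<le> norm (mathieu \<alpha> \<beta> \<theta>' v - E *\<^sub>R v)"
proof (rule field_le_epsilon)
  fix e :: real assume "e > 0"
  \<comment> \<open>Chosen so that the Lipschitz error stays below \<open>e\<close>; the summand 1
    keeps the denominator positive when \<beta> or \<open>v\<close> vanishes.\<close>
  define d where "d = e / (2 * \<bar>\<beta>\<bar> * norm v + 1)"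
  have pos: "2 * \<bar>\<beta>\<bar> * norm v + 1 > 0" by (simp add: add_nonneg_pos)
  then have "d > 0" using \<open>e > 0\<close> by (simp add: d_def)
  obtain k j :: int where kj: "\<bar>2 * pi * \<alpha> * of_int k + 2 * pi * of_int j - (\<theta>' - \<theta>)\<bar> < d"
    by (rule dense_rotation[OF assms(1) \<open>d > 0\<close>])
  define \<theta>'' where "\<theta>'' = \<theta> + 2 * pi * \<alpha> * of_int k + 2 * pi * of_int j"
  have "m * norm v \<le> norm (mathieu \<alpha> \<beta> \<theta>'' v - E *\<^sub>R v)"
    unfolding \<theta>''_def mathieu_periodic by (rule mathieu_lower_bound_shift[OF m])
  also have "\<dots> \<le> norm (mathieu \<alpha> \<beta> \<theta>' v - E *\<^sub>R v) + norm (mathieu \<alpha> \<beta> \<theta>'' v - mathieu \<alpha> \<beta> \<theta>' v)"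
    using norm_triangle_ineq[of "mathieu \<alpha> \<beta> \<theta>' v - E *\<^sub>R v" "mathieu \<alpha> \<beta> \<theta>'' v - mathieu \<alpha> \<beta> \<theta>' v"]
    by simp
  also have "norm (mathieu \<alpha> \<beta> \<theta>'' v - mathieu \<alpha> \<beta> \<theta>' v) \<le> 2 * \<bar>\<beta>\<bar> * \<bar>\<theta>'' - \<theta>'\<bar> * norm v"
    by (rule norm_mathieu_diff)
  also have "\<dots> = (2 * \<bar>\<beta>\<bar> * norm v) * \<bar>\<theta>'' - \<theta>'\<bar>" by simp
  also have "\<dots> \<le> (2 * \<bar>\<beta>\<bar> * norm v + 1) * d"
    using kj by (intro mult_mono) (auto simp: \<theta>''_def algebra_simps)
  also have "\<dots> = e" using pos by (simp add: d_def)
  finally show "m * norm v \<le> norm (mathieu \<alpha> \<beta> \<theta>' v - E *\<^sub>R v) + e" by simp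
qed

lemma ap_spec_phase:
  assumes "\<alpha> \<notin> \<rat>"
  shows "ap_spec \<alpha> \<beta> = {E. \<not> bounded_below (\<lambda>v. mathieu \<alpha> \<beta> \<theta> v - E *\<^sub>R v)}"
  unfolding ap_spec_def bounded_below_def
  using mathieu_lower_bound_phase[OF assms, of _ \<beta> 0 _ _ \<theta>] mathieu_lower_bound_phase[OF assms, of _ \<beta> \<theta> _ _ 0]
  by blast

lemma bounded_below_phase:
  assumes "\<alpha> \<notin> \<rat>" "E \<notin> ap_spec \<alpha> \<beta>"
  shows "bounded_below (\<lambda>v. mathieu \<alpha> \<beta> \<theta> v - E *\<^sub>R v)"
  using assms(2) by (simp add: ap_spec_phase[OF assms(1), of \<beta> \<theta>])

lemma closed_ap_spec: "closed (ap_spec \<alpha> \<beta>)"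
proof -
  have "open {E. bounded_below (\<lambda>v. mathieu \<alpha> \<beta> 0 v - E *\<^sub>R v)}"
    unfolding open_dist
  proof safe
    fix E assume "bounded_below (\<lambda>v. mathieu \<alpha> \<beta> 0 v - E *\<^sub>R v)"
    then obtain m where m: "m > 0" "\<And>v. m * norm v \<le> norm (mathieu \<alpha> \<beta> 0 v - E *\<^sub>R v)"
      by (auto simp: bounded_below_def)
    have "bounded_below (\<lambda>v. mathieu \<alpha> \<beta> 0 v - F *\<^sub>R v)" if F: "dist F E < m" for F
      unfolding bounded_below_def
    proof (intro exI[of _ "m - dist F E"] conjI allI)
      fix v
      have "norm (mathieu \<alpha> \<beta> 0 v - E *\<^sub>R v)
          \<le> norm (mathieu \<alpha> \<beta> 0 v - F *\<^sub>R v) + norm ((F - E) *\<^sub>R v)"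
        using norm_triangle_ineq[of "mathieu \<alpha> \<beta> 0 v - F *\<^sub>R v" "(F - E) *\<^sub>R v"]
        by (simp add: scaleR_diff_left)
      then have "norm (mathieu \<alpha> \<beta> 0 v - E *\<^sub>R v)
          \<le> norm (mathieu \<alpha> \<beta> 0 v - F *\<^sub>R v) + \<bar>F - E\<bar> * norm v"
        by simp
      then show "(m - dist F E) * norm v \<le> norm (mathieu \<alpha> \<beta> 0 v - F *\<^sub>R v)"
        using m(2)[of v] by (simp add: dist_real_def algebra_simps)
    qed (use F in simp)
    then show "\<exists>e>0. \<forall>F. dist F E < e \<longrightarrow> F \<in> {E. bounded_below (\<lambda>v. mathieu \<alpha> \<beta> 0 v - E *\<^sub>R v)}"
      using m(1) by blast
  qed
  then show ?thesis
    by (simp add: ap_spec_def closed_def Collect_neg_eq[symmetric])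
qed

lemma square_summable_single: "(\<lambda>n. (if n = a then 1 else 0 :: real)\<^sup>2) summable_on UNIV"
  by (rule finite_nonzero_values_imp_summable_on)
    (rule finite_subset[of _ "{a}"], auto)

lemma ap_spec_nonempty: "ap_spec \<alpha> \<beta> \<noteq> {}"
proof -
  define u where "u = Sq (\<lambda>n. if n = 0 then 1 else 0)"
  have "coord u 0 = 1"
    by (simp add: u_def Sq_inverse square_summable_single)
  then have "u \<noteq> 0" by auto
  from symmetric_operator.not_all_bounded_below[OF mathieu_symmetric_operator this, of \<alpha> \<beta> 0]
  show ?thesis by (auto simp: ap_spec_def)
qed

lemma ap_spec_eigenvalue:
  assumes "\<alpha> \<notin> \<rat>" "mathieu \<alpha> \<beta> \<theta> v = E *\<^sub>R v" "v \<noteq> 0"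
  shows "E \<in> ap_spec \<alpha> \<beta>"
  unfolding ap_spec_phase[OF assms(1), of \<beta> \<theta>] bounded_below_def
  using assms(2,3) by (auto simp: not_le intro!: exI[of _ v])

text \<open>A bounded inverse with norm bound \<open>K\<close> yields the lower bound
  \<open>1 / K\<close>; it is tested on real sequences embedded in \<open>ell2\<close>.\<close>

lemma ap_spec_subset_Sp: "ap_spec \<alpha> \<beta> \<subseteq> Sp \<alpha> \<beta>"
proof
  fix E assume E: "E \<in> ap_spec \<alpha> \<beta>"
  show "E \<in> Sp \<alpha> \<beta>"
  proof (rule ccontr)
    assume "E \<notin> Sp \<alpha> \<beta>"
    then obtain R where R: "ell2_bounded_operator R"
      and inv: "\<And>x. x \<in> ell2 \<Longrightarrow> R (\<lambda>n. almost_mathieu \<alpha> \<beta> 0 x n - complex_of_real E * x n) = x"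
      by (auto simp: Sp_def ell2_spectrum_def)
    obtain K where K: "\<And>x. x \<in> ell2 \<Longrightarrow> ell2_norm (R x) \<le> K * ell2_norm x"
      using R unfolding ell2_bounded_operator_def by blast
    define c where "c = (\<lambda>v n. complex_of_real (coord v n))"
    have c: "c v \<in> ell2" "ell2_norm (c v) = norm v" for v
      by (simp_all add: c_def ell2_def summable_coord_square ell2_norm_def norm_sq_square[symmetric])
    \<comment> \<open>The constant \<open>K\<close> in the definition of boundedness may be
      nonpositive, hence the maximum with 1.\<close>
    have "1 / max K 1 * norm v \<le> norm (mathieu \<alpha> \<beta> 0 v - E *\<^sub>R v)" for v
    proof -
      define w where "w = mathieu \<alpha> \<beta> 0 v - E *\<^sub>R v"
      have "c w = (\<lambda>n. almost_mathieu \<alpha> \<beta> 0 (c v) n - complex_of_real E * c v n)"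
        by (auto simp: c_def w_def almost_mathieu_def coord_mathieu)
      then have "R (c w) = c v" using inv[OF c(1)[of v]] by simp
      then have "norm v \<le> K * norm w" using K[OF c(1)[of w]] by (simp add: c)
      also have "\<dots> \<le> max K 1 * norm w" by (intro mult_right_mono) auto
      finally show ?thesis by (simp add: w_def field_simps)
    qed
    then have "bounded_below (\<lambda>v. mathieu \<alpha> \<beta> 0 v - E *\<^sub>R v)"
      unfolding bounded_below_def by (intro exI[of _ "1 / max K 1"]) auto
    then show False using E by (simp add: ap_spec_def)
  qed
qed

text \<open>A pointwise condition without summability, so that it also covers the merely bounded
  solutions that appear as coordinatewise limits.\<close>

definition solves :: "real \<Rightarrow> real \<Rightarrow> real \<Rightarrow> real \<Rightarrow> (int \<Rightarrow> real) \<Rightarrow> bool" where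
  "solves \<alpha> \<beta> \<theta> E \<xi> \<longleftrightarrow>
     (\<forall>n. \<xi> (n + 1) + \<xi> (n - 1) + 2 * \<beta> * cos (2 * pi * \<alpha> * of_int n + \<theta>) * \<xi> n = E * \<xi> n)"

lemma solves_add_scaled:
  assumes "solves \<alpha> \<beta> \<theta> E \<xi>" "solves \<alpha> \<beta> \<theta> E \<eta>"
  shows "solves \<alpha> \<beta> \<theta> E (\<lambda>n. \<xi> n + c * \<eta> n)"
  unfolding solves_def
proof
  fix n
  let ?v = "2 * \<beta> * cos (2 * pi * \<alpha> * of_int n + \<theta>)"
  have "\<xi> (n + 1) + \<xi> (n - 1) + ?v * \<xi> n = E * \<xi> n" "\<eta> (n + 1) + \<eta> (n - 1) + ?v * \<eta> n = E * \<eta> n"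
    using assms by (auto simp: solves_def)
  then show "\<xi> (n + 1) + c * \<eta> (n + 1) + (\<xi> (n - 1) + c * \<eta> (n - 1)) + ?v * (\<xi> n + c * \<eta> n)
      = E * (\<xi> n + c * \<eta> n)"
    by algebra
qed

lemma solves_eq_0:
  assumes "solves \<alpha> \<beta> \<theta> E \<xi>" "\<xi> 0 = 0" "\<xi> 1 = 0"
  shows "\<xi> n = 0"
proof -
  have rec: "\<xi> (n + 1) + \<xi> (n - 1) + 2 * \<beta> * cos (2 * pi * \<alpha> * of_int n + \<theta>) * \<xi> n = E * \<xi> n" for n
    using assms(1) by (auto simp: solves_def)
  have "\<xi> n = 0 \<and> \<xi> (n + 1) = 0"
  proof (induction n rule: int_induct[where k = 0])
    case (step1 i)
    then show ?case using rec[of "i + 1"] by (simp add: add.commute)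
  next
    case (step2 i)
    then show ?case using rec[of i] by simp
  qed (use assms in simp)
  then show ?thesis ..
qed

text \<open>The Wronskian of two solutions is constant in \<open>n\<close>, and it tends to 0 at
  plus infinity because \<xi> decays and \<eta> is bounded. With Wronskian 0, the combination of
  \<eta> and \<xi> that vanishes at 0 vanishes at 1 too, hence everywhere.\<close>

lemma solves_unique:
  assumes \<xi>: "solves \<alpha> \<beta> \<theta> E \<xi>" and \<eta>: "solves \<alpha> \<beta> \<theta> E \<eta>"
    and "\<xi> 0 = 1" and lim: "(\<lambda>n. \<xi> (int n)) \<longlonglongrightarrow> 0" and bdd: "\<And>n. \<bar>\<eta> n\<bar> \<le> M"
  shows "\<eta> n = \<eta> 0 * \<xi> n"
proof -
  define W where "W = (\<lambda>n. \<xi> (n + 1) * \<eta> n - \<xi> n * \<eta> (n + 1))"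
  have step: "W (n + 1) = W n" for n
  proof -
    let ?v = "2 * \<beta> * cos (2 * pi * \<alpha> * of_int (n + 1) + \<theta>)"
    have "\<xi> (n + 2) + \<xi> n + ?v * \<xi> (n + 1) = E * \<xi> (n + 1)"
      "\<eta> (n + 2) + \<eta> n + ?v * \<eta> (n + 1) = E * \<eta> (n + 1)"
      using \<xi> \<eta> unfolding solves_def by (auto dest!: spec[of _ "n + 1"] simp: add.assoc)
    then have "\<xi> (n + 2) * \<eta> (n + 1) - \<xi> (n + 1) * \<eta> (n + 2) = \<xi> (n + 1) * \<eta> n - \<xi> n * \<eta> (n + 1)"
      by algebra
    then show ?thesis by (simp add: W_def add.assoc)
  qed
  have W: "W (int n) = W 0" for n
  proof (induction n)
    case (Suc n)
    then show ?case using step[of "int n"] by (simp add: add.commute)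
  qed simp
  have "(\<lambda>n. W (int n)) \<longlonglongrightarrow> 0"
  proof -
    have l1: "(\<lambda>n. \<xi> (int n + 1)) \<longlonglongrightarrow> 0"
      using LIMSEQ_Suc[OF lim] by (simp add: add.commute)
    have "(\<lambda>n. \<xi> (int n + 1) * \<eta> (int n)) \<longlonglongrightarrow> 0" "(\<lambda>n. \<xi> (int n) * \<eta> (int n + 1)) \<longlonglongrightarrow> 0"
      by (rule tendsto_0_le[OF l1, of _ M] tendsto_0_le[OF lim, of _ M],
          auto simp: abs_mult intro!: always_eventually mult_left_mono bdd)+
    from tendsto_diff[OF this] show ?thesis by (simp add: W_def)
  qed
  then have "W 0 = 0" unfolding W by (simp add: LIMSEQ_const_iff)
  have "solves \<alpha> \<beta> \<theta> E (\<lambda>n. \<eta> n + (- \<eta> 0) * \<xi> n)"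
    by (rule solves_add_scaled[OF \<eta> \<xi>])
  from solves_eq_0[OF this, of n] show ?thesis
    using \<open>\<xi> 0 = 1\<close> \<open>W 0 = 0\<close> by (simp add: W_def mult.commute)
qed

lemma summable_on_exp_abs_int:
  assumes "\<gamma> > 0"
  shows "(\<lambda>n::int. exp (- \<gamma> * \<bar>real_of_int n\<bar>)) summable_on UNIV"
proof -
  let ?f = "\<lambda>n::int. exp (- \<gamma> * \<bar>real_of_int n\<bar>)"
  have s: "(\<lambda>n. exp (- \<gamma> * real n)) summable_on UNIV"
  proof -
    have "summable (\<lambda>n. exp (- \<gamma>) ^ n)" using assms by (intro summable_geometric) auto
    then have "summable (\<lambda>n. exp (- \<gamma> * real n))" by (simp add: exp_of_nat_mult[symmetric] mult.commute)
    then show ?thesis by (subst summable_on_UNIV_nonneg_real_iff) auto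
  qed
  have "?f summable_on range int"
    by (subst summable_on_reindex) (use s in \<open>auto simp: o_def\<close>)
  moreover have "?f summable_on range (\<lambda>n. - int n)"
    by (subst summable_on_reindex) (use s in \<open>auto simp: o_def inj_def\<close>)
  ultimately have "?f summable_on (range int \<union> range (\<lambda>n. - int n))"
    by (rule summable_on_union)
  also have "range int \<union> range (\<lambda>n. - int n) = UNIV"
    by (auto intro: int_cases2)
  finally show ?thesis .
qed

section \<open>Localized eigenvectors\<close>

text \<open>One natural number serves both as amplitude and as decay length, so countably many
  classes exhaust all localized eigenvectors. The normalization at 0 keeps limits within one class
  from degenerating to zero.\<close>

definition localized :: "real \<Rightarrow> real \<Rightarrow> nat \<Rightarrow> real \<Rightarrow> real \<Rightarrow> (int \<Rightarrow> real) \<Rightarrow> bool" where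
  "localized \<alpha> \<beta> k E \<theta> \<xi> \<longleftrightarrow> \<xi> 0 = 1 \<and> (\<forall>n. \<bar>\<xi> n\<bar> \<le> k * exp (- \<bar>real_of_int n\<bar> / k)) \<and> solves \<alpha> \<beta> \<theta> E \<xi>"

lemma localized_pos: "localized \<alpha> \<beta> k E \<theta> \<xi> \<Longrightarrow> k > 0"
  by (cases k) (auto simp: localized_def dest: spec[of _ 0])

lemma summable_on_localization_bound:
  assumes "k > 0"
  shows "(\<lambda>n::int. real k * exp (- \<bar>real_of_int n\<bar> / k)) summable_on UNIV"
  using summable_on_cmult_right[OF summable_on_exp_abs_int[of "1 / real k"], of "real k"] assms
  by simp

lemma localized_summable:
  assumes "localized \<alpha> \<beta> k E \<theta> \<xi>"
  shows "(\<lambda>n. \<bar>\<xi> n\<bar>) summable_on UNIV"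
  by (rule summable_on_comparison_test[OF summable_on_localization_bound[OF localized_pos[OF assms]]])
    (use assms in \<open>auto simp: localized_def\<close>)

lemma localized_le:
  assumes "localized \<alpha> \<beta> k E \<theta> \<xi>"
  shows "\<bar>\<xi> n\<bar> \<le> k"
proof -
  have "\<bar>\<xi> n\<bar> \<le> k * exp (- \<bar>real_of_int n\<bar> / k)" using assms by (simp add: localized_def)
  also have "\<dots> \<le> real k * 1" by (intro mult_left_mono) auto
  finally show ?thesis by simp
qed

text \<open>A bound on the squared norm depending on \<open>k\<close> alone: one factor of the
  square is estimated by \<open>k\<close>, the other by the exponential envelope.\<close>

definition localization_norm :: "nat \<Rightarrow> real" where
  "localization_norm k = (\<Sum>\<^sub>\<infinity>n::int. real k * (real k * exp (- \<bar>real_of_int n\<bar> / k)))"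

lemma localized_vector:
  assumes "localized \<alpha> \<beta> k E \<theta> \<xi>"
  obtains v where "coord v = \<xi>" "mathieu \<alpha> \<beta> \<theta> v = E *\<^sub>R v" "v \<noteq> 0"
    "(norm v)\<^sup>2 \<le> localization_norm k"
proof
  define v where "v = Sq \<xi>"
  have bound: "(\<xi> n)\<^sup>2 \<le> real k * (real k * exp (- \<bar>real_of_int n\<bar> / k))" for n
  proof -
    have "\<bar>\<xi> n\<bar> * \<bar>\<xi> n\<bar> \<le> real k * (real k * exp (- \<bar>real_of_int n\<bar> / k))"
      using assms by (intro mult_mono localized_le[OF assms]) (auto simp: localized_def)
    then show ?thesis by (simp add: power2_eq_square)
  qed
  have s: "(\<lambda>n. real k * (real k * exp (- \<bar>real_of_int n\<bar> / k))) summable_on (UNIV :: int set)"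
    by (intro summable_on_cmult_right[of _ _ "real k"] summable_on_localization_bound localized_pos[OF assms])
  have sq: "(\<lambda>n. (\<xi> n)\<^sup>2) summable_on UNIV"
    by (rule summable_on_comparison_test[OF s]) (use bound in auto)
  then show c: "coord v = \<xi>" by (simp add: v_def Sq_inverse)
  show "mathieu \<alpha> \<beta> \<theta> v = E *\<^sub>R v"
    using assms by (intro sq_eqI) (simp add: coord_mathieu c localized_def solves_def)
  have "coord v 0 = 1" using assms by (simp add: c localized_def)
  then show "v \<noteq> 0" by auto
  show "(norm v)\<^sup>2 \<le> localization_norm k"
    unfolding norm_sq_square c localization_norm_def by (rule infsum_mono[OF sq s bound])
qed

lemma localization_bound_tendsto_0:
  assumes "k > 0"
  shows "(\<lambda>n. real k * exp (- (1 / real k) * real n)) \<longlonglongrightarrow> 0"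
proof -
  have "filterlim (\<lambda>n. (1 / real k) * real n) at_top sequentially"
    by (rule filterlim_tendsto_pos_mult_at_top[OF tendsto_const _ filterlim_real_sequentially])
      (use assms in simp)
  then have "(\<lambda>n. exp (- (1 / real k * real n))) \<longlonglongrightarrow> 0"
    by (intro filterlim_compose[OF exp_at_bot] filterlim_compose[OF filterlim_uminus_at_bot_at_top])
  from tendsto_mult_left[OF this, of "real k"] show ?thesis by simp
qed

lemma localized_tendsto_0:
  assumes "localized \<alpha> \<beta> k E \<theta> \<xi>"
  shows "(\<lambda>n. \<xi> (int n)) \<longlonglongrightarrow> 0"
proof (rule Lim_null_comparison)
  show "\<forall>\<^sub>F n in sequentially. norm (\<xi> (int n)) \<le> k * exp (- (1 / k) * real n)"
    using assms by (auto simp: localized_def dest!: spec[of _ "int _"] intro!: always_eventually)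
qed (rule localization_bound_tendsto_0[OF localized_pos[OF assms]])

lemma solves_Re_Im:
  assumes "almost_mathieu \<alpha> \<beta> \<theta> \<xi> = (\<lambda>n. complex_of_real E * \<xi> n)"
  shows "solves \<alpha> \<beta> \<theta> E (\<lambda>n. Re (\<xi> n))" "solves \<alpha> \<beta> \<theta> E (\<lambda>n. Im (\<xi> n))"
proof -
  have *: "\<xi> (n + 1) + \<xi> (n - 1) + complex_of_real (2 * \<beta> * cos (2 * pi * \<alpha> * of_int n + \<theta>)) * \<xi> n
      = complex_of_real E * \<xi> n" for n
    using fun_cong[OF assms, of n] by (simp add: almost_mathieu_def)
  show "solves \<alpha> \<beta> \<theta> E (\<lambda>n. Re (\<xi> n))" "solves \<alpha> \<beta> \<theta> E (\<lambda>n. Im (\<xi> n))"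
    unfolding solves_def using arg_cong[OF *, of Re] arg_cong[OF *, of Im] by simp_all
qed

lemma solves_translate:
  assumes "solves \<alpha> \<beta> \<theta> E \<xi>"
  shows "solves \<alpha> \<beta> (\<theta> + 2 * pi * \<alpha> * of_int a + 2 * pi * of_int j) E (\<lambda>n. \<xi> (n + a) * c)"
  unfolding solves_def
proof
  fix n
  have "2 * pi * \<alpha> * of_int n + (\<theta> + 2 * pi * \<alpha> * of_int a + 2 * pi * of_int j)
      = (2 * pi * \<alpha> * of_int (n + a) + \<theta>) + 2 * pi * of_int j"
    by (simp add: algebra_simps)
  also have "cos \<dots> = cos (2 * pi * \<alpha> * of_int (n + a) + \<theta>)"
    using cos.plus_of_int[of "2 * pi * \<alpha> * of_int (n + a) + \<theta>" j] by (simp add: algebra_simps)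
  finally have C: "cos (2 * pi * \<alpha> * of_int n + (\<theta> + 2 * pi * \<alpha> * of_int a + 2 * pi * of_int j))
      = cos (2 * pi * \<alpha> * of_int (n + a) + \<theta>)" .
  have "\<xi> (n + a + 1) + \<xi> (n + a - 1) + 2 * \<beta> * cos (2 * pi * \<alpha> * of_int (n + a) + \<theta>) * \<xi> (n + a)
      = E * \<xi> (n + a)"
    by (rule assms[unfolded solves_def, rule_format])
  moreover have "n + 1 + a = n + a + 1" "n - 1 + a = n + a - 1" by auto
  ultimately show "\<xi> (n + 1 + a) * c + \<xi> (n - 1 + a) * c + 2 * \<beta> *
      cos (2 * pi * \<alpha> * of_int n + (\<theta> + 2 * pi * \<alpha> * of_int a + 2 * pi * of_int j)) * (\<xi> (n + a) * c)
      = E * (\<xi> (n + a) * c)"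
    unfolding C by (metis (no_types, opaque_lifting) distrib_right mult.assoc)
qed

text \<open>A site \<open>a\<close> where the eigenvector is nonzero is translated to 0 and the
  value there scaled to 1. This rotates the phase, which is then reduced modulo 2 pi into a compact
  interval.\<close>

lemma exists_localized:
  assumes ev: "ell2_eigenvector (almost_mathieu \<alpha> \<beta> \<theta>) (complex_of_real E) \<xi>"
    and dec: "decays_exponentially \<xi>"
  shows "\<exists>k \<theta>' \<eta>. \<theta>' \<in> {0..2 * pi} \<and> localized \<alpha> \<beta> k E \<theta>' \<eta>"
proof -
  obtain C \<gamma> where C: "C > 0" "\<gamma> > 0" "\<And>n. cmod (\<xi> n) \<le> C * exp (- \<gamma> * \<bar>real_of_int n\<bar>)"
    using dec by (auto simp: decays_exponentially_def)
  have eq: "almost_mathieu \<alpha> \<beta> \<theta> \<xi> = (\<lambda>n. complex_of_real E * \<xi> n)"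
    using ev by (simp add: ell2_eigenvector_def)
  obtain a where "\<xi> a \<noteq> 0" using ev by (auto simp: ell2_eigenvector_def)
  then have "Re (\<xi> a) \<noteq> 0 \<or> Im (\<xi> a) \<noteq> 0" by (auto simp: complex_eq_iff)
  then obtain \<zeta> where \<zeta>: "\<zeta> a \<noteq> 0" "solves \<alpha> \<beta> \<theta> E \<zeta>" "\<And>n. \<bar>\<zeta> n\<bar> \<le> cmod (\<xi> n)"
    using solves_Re_Im[OF eq] abs_Re_le_cmod abs_Im_le_cmod by metis
  define j where "j = - \<lfloor>(\<theta> + 2 * pi * \<alpha> * of_int a) / (2 * pi)\<rfloor>"
  define \<theta>' where "\<theta>' = \<theta> + 2 * pi * \<alpha> * of_int a + 2 * pi * of_int j"
  have "\<theta>' = 2 * pi * frac ((\<theta> + 2 * pi * \<alpha> * of_int a) / (2 * pi))"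
    by (simp add: \<theta>'_def j_def frac_def field_simps)
  then have \<theta>': "\<theta>' \<in> {0..2 * pi}"
    using frac_lt_1[of "(\<theta> + 2 * pi * \<alpha> * of_int a) / (2 * pi)"] by auto
  \<comment> \<open>The price of recentring at \<open>a\<close>: a factor
    \<open>exp (\<gamma> * \<bar>real_of_int a\<bar>)\<close> from the triangle inequality and the
    division by the value at \<open>a\<close>.\<close>
  define D where "D = C * exp (\<gamma> * \<bar>real_of_int a\<bar>) / \<bar>\<zeta> a\<bar>"
  have "D > 0" using C(1) \<zeta>(1) by (simp add: D_def)
  obtain k :: nat where k: "max D (1 / \<gamma>) \<le> real k" using real_arch_simple by blast
  have "0 < max D (1 / \<gamma>)" using \<open>D > 0\<close> by simp
  with k have "real k > 0" by linarith
  have "\<gamma> \<ge> 1 / k" using k C(2) \<open>real k > 0\<close> by (simp add: field_simps)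
  have "localized \<alpha> \<beta> k E \<theta>' (\<lambda>n. \<zeta> (n + a) * (1 / \<zeta> a))"
    unfolding localized_def
  proof (intro conjI allI)
    show "solves \<alpha> \<beta> \<theta>' E (\<lambda>n. \<zeta> (n + a) * (1 / \<zeta> a))"
      unfolding \<theta>'_def by (rule solves_translate[OF \<zeta>(2)])
    show "\<bar>\<zeta> (n + a) * (1 / \<zeta> a)\<bar> \<le> k * exp (- \<bar>real_of_int n\<bar> / k)" for n
    proof -
      have "\<bar>\<zeta> (n + a)\<bar> \<le> C * exp (- \<gamma> * \<bar>real_of_int (n + a)\<bar>)"
        using \<zeta>(3) C(3) by (rule order.trans)
      also have "\<dots> \<le> C * exp (\<gamma> * \<bar>real_of_int a\<bar> + - \<gamma> * \<bar>real_of_int n\<bar>)"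
      proof -
        have "\<bar>real_of_int n\<bar> \<le> \<bar>real_of_int (n + a)\<bar> + \<bar>real_of_int a\<bar>" by simp
        from mult_left_mono[OF this, of \<gamma>] C(1,2) show ?thesis
          by (simp add: algebra_simps)
      qed
      also have "\<dots> = D * \<bar>\<zeta> a\<bar> * exp (- \<gamma> * \<bar>real_of_int n\<bar>)"
        using \<zeta>(1) unfolding exp_add D_def by simp
      finally have "\<bar>\<zeta> (n + a) * (1 / \<zeta> a)\<bar> \<le> D * exp (- \<gamma> * \<bar>real_of_int n\<bar>)"
        using \<zeta>(1) by (simp add: abs_mult field_simps)
      also have "\<dots> \<le> k * exp (- (1 / k) * \<bar>real_of_int n\<bar>)"
        using k mult_right_mono[OF \<open>\<gamma> \<ge> 1 / k\<close>, of "\<bar>real_of_int n\<bar>"] by (intro mult_mono) auto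
      finally show ?thesis by simp
    qed
  qed (use \<zeta>(1) in simp)
  with \<theta>' show ?thesis by blast
qed

section \<open>The phase derivative at a gap edge\<close>

lemma cos_mult_add:
  "cos_mult \<omega> (\<theta> + \<kappa>) v = cos \<kappa> *\<^sub>R cos_mult \<omega> \<theta> v - sin \<kappa> *\<^sub>R cos_mult \<omega> (\<theta> - pi / 2) v"
proof (rule sq_eqI)
  fix n
  have A: "cos (\<omega> * of_int n + (\<theta> + \<kappa>))
      = cos \<kappa> * cos (\<omega> * of_int n + \<theta>) - sin \<kappa> * sin (\<omega> * of_int n + \<theta>)"
    using cos_add[of "\<omega> * of_int n + \<theta>" \<kappa>] by (simp add: algebra_simps)
  have B: "cos (\<omega> * of_int n + (\<theta> - pi / 2)) = sin (\<omega> * of_int n + \<theta>)"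
    using cos_diff[of "\<omega> * of_int n + \<theta>" "pi / 2"] by (simp add: algebra_simps)
  show "coord (cos_mult \<omega> (\<theta> + \<kappa>) v) n
      = coord (cos \<kappa> *\<^sub>R cos_mult \<omega> \<theta> v - sin \<kappa> *\<^sub>R cos_mult \<omega> (\<theta> - pi / 2) v) n"
    unfolding coord_simps coord_cos_mult A B by (simp add: algebra_simps)
qed

text \<open>A Hellmann--Feynman argument: every phase has the same gap next to \<open>E\<close>, so the form of the
  gap at phase \<open>\<theta> + \<kappa>\<close>, evaluated at the eigenvector for \<open>\<theta>\<close>, is minimal at \<open>\<kappa> = 0\<close>.\<close>

lemma phase_derivative_zero_at_gap_edge:
  assumes irr: "\<alpha> \<notin> \<rat>" and v: "mathieu \<alpha> \<beta> \<theta> v = E *\<^sub>R v" and "e > 0"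
    and gap: "{E<..<E + e} \<inter> ap_spec \<alpha> \<beta> = {} \<or> {E - e<..<E} \<inter> ap_spec \<alpha> \<beta> = {}"
  shows "\<beta> * (v \<bullet> cos_mult (2 * pi * \<alpha>) (\<theta> - pi / 2) v) = 0"
proof -
  define w where "w = (\<lambda>\<kappa>. mathieu \<alpha> \<beta> (\<theta> + \<kappa>) v - E *\<^sub>R v)"
  define c where "c = v \<bullet> cos_mult (2 * pi * \<alpha>) \<theta> v"
  \<comment> \<open>The cosine at phase \<theta> - pi / 2 is the sine at phase \<theta>, so
    \<open>s\<close> is minus the phase derivative of \<open>c\<close>.\<close>
  define s where "s = v \<bullet> cos_mult (2 * pi * \<alpha>) (\<theta> - pi / 2) v"
  have "\<exists>\<sigma>. \<bar>\<sigma>\<bar> = 1 \<and> (\<forall>\<kappa>. 0 \<le> (norm (w \<kappa>))\<^sup>2 + \<sigma> * e * (w \<kappa> \<bullet> v))"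
    using gap
  proof
    assume g: "{E<..<E + e} \<inter> ap_spec \<alpha> \<beta> = {}"
    have "0 \<le> (mathieu \<alpha> \<beta> (\<theta> + \<kappa>) v - E *\<^sub>R v) \<bullet> (mathieu \<alpha> \<beta> (\<theta> + \<kappa>) v - (E + e) *\<^sub>R v)" for \<kappa>
      by (rule symmetric_operator.form_nonneg_of_spectral_gap[OF mathieu_symmetric_operator])
        (use g \<open>e > 0\<close> in \<open>auto intro!: bounded_below_phase[OF irr]\<close>)
    moreover have "mathieu \<alpha> \<beta> (\<theta> + \<kappa>) v - (E + e) *\<^sub>R v = w \<kappa> - e *\<^sub>R v" for \<kappa>
      by (simp add: w_def algebra_simps)
    ultimately have "0 \<le> w \<kappa> \<bullet> (w \<kappa> - e *\<^sub>R v)" for \<kappa>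
      by (simp only: w_def)
    then have "\<forall>\<kappa>. 0 \<le> (norm (w \<kappa>))\<^sup>2 + (- 1) * e * (w \<kappa> \<bullet> v)"
      by (simp add: inner_diff_right power2_norm_eq_inner)
    then show ?thesis by (intro exI[of _ "- 1"]) simp
  next
    assume g: "{E - e<..<E} \<inter> ap_spec \<alpha> \<beta> = {}"
    have "0 \<le> (mathieu \<alpha> \<beta> (\<theta> + \<kappa>) v - (E - e) *\<^sub>R v) \<bullet> (mathieu \<alpha> \<beta> (\<theta> + \<kappa>) v - E *\<^sub>R v)" for \<kappa>
      by (rule symmetric_operator.form_nonneg_of_spectral_gap[OF mathieu_symmetric_operator])
        (use g \<open>e > 0\<close> in \<open>auto intro!: bounded_below_phase[OF irr]\<close>)
    moreover have "mathieu \<alpha> \<beta> (\<theta> + \<kappa>) v - (E - e) *\<^sub>R v = w \<kappa> + e *\<^sub>R v" for \<kappa>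
      by (simp add: w_def algebra_simps)
    ultimately have "0 \<le> (w \<kappa> + e *\<^sub>R v) \<bullet> w \<kappa>" for \<kappa>
      by (simp only: w_def)
    then have "\<forall>\<kappa>. 0 \<le> (norm (w \<kappa>))\<^sup>2 + 1 * e * (w \<kappa> \<bullet> v)"
      by (simp add: inner_add_left inner_add_right power2_norm_eq_inner inner_commute)
    then show ?thesis by (intro exI[of _ 1]) simp
  qed
  then obtain \<sigma> where \<sigma>: "\<bar>\<sigma>\<bar> = 1" "\<And>\<kappa>. 0 \<le> (norm (w \<kappa>))\<^sup>2 + \<sigma> * e * (w \<kappa> \<bullet> v)" by blast
  \<comment> \<open>The vector \<open>w\<close> is at most linear in \<kappa>, so the square of its
    norm has a quadratic majorant. The resulting \<open>g\<close> is explicit, nonnegative and zero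
    at 0, and its derivative there sees only the term with \<open>s\<close>.\<close>
  define g where "g = (\<lambda>\<kappa>. (2 * \<bar>\<beta>\<bar> * norm v)\<^sup>2 * \<kappa>\<^sup>2 + \<sigma> * e * (2 * \<beta> * ((cos \<kappa> - 1) * c - sin \<kappa> * s)))"
  have nonneg: "0 \<le> g \<kappa>" for \<kappa>
  proof -
    have "w \<kappa> = mathieu \<alpha> \<beta> (\<theta> + \<kappa>) v - mathieu \<alpha> \<beta> \<theta> v" by (simp add: w_def v)
    also have "\<dots> = (2 * \<beta>) *\<^sub>R (cos_mult (2 * pi * \<alpha>) (\<theta> + \<kappa>) v - cos_mult (2 * pi * \<alpha>) \<theta> v)"
      by (rule mathieu_diff)
    finally have w: "w \<kappa> = (2 * \<beta>) *\<^sub>R (cos_mult (2 * pi * \<alpha>) (\<theta> + \<kappa>) v - cos_mult (2 * pi * \<alpha>) \<theta> v)" .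
    have "w \<kappa> \<bullet> v = 2 * \<beta> * ((cos \<kappa> - 1) * c - sin \<kappa> * s)"
      unfolding w cos_mult_add by (simp add: inner_diff_left c_def s_def inner_commute algebra_simps)
    moreover have "norm (w \<kappa>) \<le> 2 * \<bar>\<beta>\<bar> * \<bar>\<kappa>\<bar> * norm v"
      using norm_mathieu_diff[of \<alpha> \<beta> "\<theta> + \<kappa>" v \<theta>] by (simp add: w_def v)
    then have "(norm (w \<kappa>))\<^sup>2 \<le> (2 * \<bar>\<beta>\<bar> * norm v)\<^sup>2 * \<kappa>\<^sup>2"
      using power_mono[of "norm (w \<kappa>)" "2 * \<bar>\<beta>\<bar> * \<bar>\<kappa>\<bar> * norm v" 2]
      by (simp add: power_mult_distrib algebra_simps)
    ultimately show ?thesis using \<sigma>(2)[of \<kappa>] by (simp add: g_def)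
  qed
  have "(g has_real_derivative \<sigma> * e * (2 * \<beta> * (- s))) (at 0)"
    unfolding g_def by (auto intro!: derivative_eq_intros)
  then have "\<sigma> * e * (2 * \<beta> * (- s)) = 0"
  proof (rule DERIV_local_min[of _ _ _ 1])
    show "\<forall>y. \<bar>0 - y\<bar> < 1 \<longrightarrow> g 0 \<le> g y" using nonneg by (simp add: g_def)
  qed simp
  then show ?thesis using \<sigma>(1) \<open>e > 0\<close> by (auto simp: s_def)
qed

text \<open>The increments of \<open>kernel_iteration\<close> sum to a geometric series, so the
  iterates converge in every coordinate, to a solution whose distance to \<open>v\<close> is
  controlled by the residual. The constant \<open>1 / (K * (1 - q))\<close> is the sum of that
  series.\<close>

lemma exists_solution_near:
  assumes irr: "\<alpha> \<notin> \<rat>" and "e > 0" and isolated: "\<And>F. F \<noteq> E \<Longrightarrow> \<bar>F - E\<bar> < e \<Longrightarrow> F \<notin> ap_spec \<alpha> \<beta>"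
  obtains L where "L \<ge> 0"
    "\<And>v. \<exists>l. solves \<alpha> \<beta> \<theta> E l \<and> (\<forall>n. \<bar>l n - coord v n\<bar> \<le> L * norm (mathieu \<alpha> \<beta> \<theta> v - E *\<^sub>R v))"
proof -
  define T where "T = (\<lambda>v. mathieu \<alpha> \<beta> \<theta> v - E *\<^sub>R v)"
  define K where "K = 2 + 2 * \<bar>\<beta>\<bar> + \<bar>E\<bar>"
  interpret symmetric_operator T K
    unfolding T_def K_def
    by (rule symmetric_operator.symmetric_operator_shifted[OF mathieu_symmetric_operator])
  have ge: "e * norm (T v) \<le> norm (T (T v))" for v
  proof (rule norm_square_ge_of_isolated_zero[OF \<open>e > 0\<close>])
    fix c :: real assume "c \<noteq> 0" "\<bar>c\<bar> < e"
    then have "bounded_below (\<lambda>v. mathieu \<alpha> \<beta> \<theta> v - (E + c) *\<^sub>R v)"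
      by (intro bounded_below_phase[OF irr] isolated) auto
    then show "bounded_below (\<lambda>v. T v - c *\<^sub>R v)" by (simp add: T_def algebra_simps)
  qed
  obtain q where q: "0 \<le> q" "q < 1"
    and it: "\<And>v. \<exists>s. s 0 = v \<and> (\<forall>k. norm (s (Suc k) - s k) \<le> q ^ k * norm (T v) / K \<and>
           norm (T (s k)) \<le> q ^ k * norm (T v))"
    using kernel_iteration[OF \<open>e > 0\<close> ge] by metis
  have "\<exists>l. solves \<alpha> \<beta> \<theta> E l \<and> (\<forall>n. \<bar>l n - coord v n\<bar> \<le> 1 / (K * (1 - q)) * norm (T v))" for v
  proof -
    obtain s where s: "s 0 = v" "\<And>k. norm (s (Suc k) - s k) \<le> q ^ k * norm (T v) / K"
      "\<And>k. norm (T (s k)) \<le> q ^ k * norm (T v)"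
      using it[of v] by blast
    have step: "\<bar>coord (s (Suc k)) n - coord (s k) n\<bar> \<le> norm (T v) / K * q ^ k" for k n
      using order.trans[OF abs_coord_le_norm[of "s (Suc k) - s k" n] s(2)[of k]] by (simp add: mult.commute)
    have geo: "summable (\<lambda>k. norm (T v) / K * q ^ k)"
      by (intro summable_mult summable_geometric) (use q in auto)
    have sm: "summable (\<lambda>k. \<bar>coord (s (Suc k)) n - coord (s k) n\<bar>)" for n
      by (rule summable_comparison_test'[OF geo, of 0]) (use step in auto)
    define l where "l = (\<lambda>n. coord v n + (\<Sum>k. coord (s (Suc k)) n - coord (s k) n))"
    have lim: "(\<lambda>k. coord (s k) n) \<longlonglongrightarrow> l n" for n
    proof -
      have "(\<lambda>k. \<Sum>i<k. coord (s (Suc i)) n - coord (s i) n) \<longlonglongrightarrow> (\<Sum>k. coord (s (Suc k)) n - coord (s k) n)"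
        by (rule summable_LIMSEQ[OF summable_rabs_cancel[OF sm]])
      then have "(\<lambda>k. coord (s k) n - coord (s 0) n) \<longlonglongrightarrow> (\<Sum>k. coord (s (Suc k)) n - coord (s k) n)"
        by (simp only: sum_lessThan_telescope[of "\<lambda>k. coord (s k) n"])
      from tendsto_add[OF tendsto_const[of "coord v n"] this] show ?thesis
        by (simp add: l_def s(1))
    qed
    have "\<bar>l n - coord v n\<bar> \<le> 1 / (K * (1 - q)) * norm (T v)" for n
    proof -
      have "\<bar>l n - coord v n\<bar> \<le> (\<Sum>k. \<bar>coord (s (Suc k)) n - coord (s k) n\<bar>)"
        unfolding l_def using summable_rabs[OF sm[of n]] by simp
      also have "\<dots> \<le> (\<Sum>k. norm (T v) / K * q ^ k)" by (rule suminf_le[OF step sm geo])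
      also have "\<dots> = norm (T v) / K * (1 / (1 - q))"
        using q by (subst suminf_mult) (auto simp: summable_geometric suminf_geometric)
      finally show ?thesis by simp
    qed
    moreover have "solves \<alpha> \<beta> \<theta> E l"
      unfolding solves_def
    proof
      fix n
      have "(\<lambda>k. coord (T (s k)) n) \<longlonglongrightarrow> l (n + 1) + l (n - 1)
          + 2 * \<beta> * cos (2 * pi * \<alpha> * of_int n + \<theta>) * l n - E * l n"
        unfolding T_def coord_simps coord_mathieu by (intro tendsto_intros lim)
      moreover have "(\<lambda>k. coord (T (s k)) n) \<longlonglongrightarrow> 0"
      proof (rule Lim_null_comparison)
        show "\<forall>\<^sub>F k in sequentially. norm (coord (T (s k)) n) \<le> q ^ k * norm (T v)"
          using order.trans[OF abs_coord_le_norm s(3)] by (auto intro: always_eventually)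
        show "(\<lambda>k. q ^ k * norm (T v)) \<longlonglongrightarrow> 0"
          using tendsto_mult_right[OF LIMSEQ_power_zero[of q], of "norm (T v)"] q by simp
      qed
      ultimately show "l (n + 1) + l (n - 1) + 2 * \<beta> * cos (2 * pi * \<alpha> * of_int n + \<theta>) * l n = E * l n"
        using LIMSEQ_unique by fastforce
    qed
    ultimately show ?thesis by blast
  qed
  then show ?thesis
    using that[of "1 / (K * (1 - q))"] q K_pos by (auto simp: T_def)
qed

text \<open>If \<open>E\<close> were isolated, far translates of the eigenvector at \<open>\<theta>\<close> that almost solve the equation
  at \<open>\<theta>\<close> would be close to genuine solutions, and these are multiples of the eigenvector itself.\<close>

lemma localized_not_isolated:
  assumes irr: "\<alpha> \<notin> \<rat>" and loc: "localized \<alpha> \<beta> k E \<theta> \<xi>" and "e > 0"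
  shows "\<exists>F \<in> ap_spec \<alpha> \<beta>. F \<noteq> E \<and> \<bar>F - E\<bar> < e"
proof (rule ccontr)
  assume neg: "\<not> ?thesis"
  obtain L where L: "L \<ge> 0"
    "\<And>v. \<exists>l. solves \<alpha> \<beta> \<theta> E l \<and> (\<forall>n. \<bar>l n - coord v n\<bar> \<le> L * norm (mathieu \<alpha> \<beta> \<theta> v - E *\<^sub>R v))"
    by (rule exists_solution_near[OF irr \<open>e > 0\<close>, of E \<beta> \<theta>]) (use neg in blast)+
  obtain v where v: "coord v = \<xi>" "mathieu \<alpha> \<beta> \<theta> v = E *\<^sub>R v" by (rule localized_vector[OF loc])
  have k: "real k > 0" using localized_pos[OF loc] by simp
  \<comment> \<open>Small enough to make the final inequality
    \<open>1 - \<delta> \<le> 2 * \<delta> * k\<close> impossible.\<close>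
  define \<delta> where "\<delta> = 1 / (4 * (1 + real k))"
  have "\<delta> > 0" using k by (simp add: \<delta>_def add_pos_pos)
  \<comment> \<open>A phase error below this makes \<open>L\<close> times the residual of the
    translate at most \<delta>; the summand 1 guards against a zero denominator.\<close>
  define \<eta> where "\<eta> = \<delta> / (L * (2 * \<bar>\<beta>\<bar> * norm v) + 1)"
  have den: "L * (2 * \<bar>\<beta>\<bar> * norm v) + 1 > 0" using L(1) by (intro add_nonneg_pos) auto
  then have "\<eta> > 0" using \<open>\<delta> > 0\<close> by (simp add: \<eta>_def)
  have "(\<lambda>n. k * exp (- (1 / k) * real n)) \<longlonglongrightarrow> 0"
    by (rule localization_bound_tendsto_0[OF localized_pos[OF loc]])
  then obtain M where M: "\<And>n. n \<ge> M \<Longrightarrow> \<bar>k * exp (- (1 / k) * real n)\<bar> < \<delta>"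
    using \<open>\<delta> > 0\<close> unfolding LIMSEQ_iff by fastforce
  define N where "N = int M + 1"
  have "N > 0" by (simp add: N_def)
  \<comment> \<open>Density gives a positive \<open>a\<close> with a small rotation error but no
    control of its size. Asking for an error smaller by the factor \<open>N\<close> and passing to
    the multiple \<open>N * a\<close> gives a translation that is both far and nearly phase
    preserving.\<close>
  obtain h a where a: "a > 0" "\<bar>of_int a * \<alpha> - of_int h - 0\<bar> < \<eta> / (2 * pi * of_int N)"
    by (rule sequence_of_fractional_parts_is_dense[OF irr, of "\<eta> / (2 * pi * of_int N)" 0])
      (use \<open>\<eta> > 0\<close> \<open>N > 0\<close> in auto)
  define m where "m = N * a"
  have "N * 1 \<le> N * a" by (rule mult_left_mono) (use a(1) \<open>N > 0\<close> in auto)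
  then have "m \<ge> N" unfolding m_def by linarith
  then have "m \<ge> int M" by (simp add: N_def)
  then have "m \<ge> 0" by simp
  define x where "x = 2 * pi * \<alpha> * of_int m + 2 * pi * of_int (- N * h)"
  have "x = (2 * pi * of_int N) * (of_int a * \<alpha> - of_int h)"
    by (simp add: x_def m_def algebra_simps)
  then have "\<bar>x\<bar> = (2 * pi * of_int N) * \<bar>of_int a * \<alpha> - of_int h\<bar>"
    using \<open>N > 0\<close> by (simp add: abs_mult)
  also have "\<dots> < \<eta>" using a(2) \<open>N > 0\<close> by (simp add: field_simps)
  finally have x: "\<bar>x\<bar> < \<eta>" .
  have "norm (mathieu \<alpha> \<beta> \<theta> (shift m v) - E *\<^sub>R shift m v) \<le> 2 * \<bar>\<beta>\<bar> * norm v * \<eta>"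
  proof -
    have \<theta>x: "\<theta> + x = \<theta> + 2 * pi * \<alpha> * of_int m + 2 * pi * of_int (- N * h)"
      by (simp add: x_def)
    have eq: "mathieu \<alpha> \<beta> \<theta> (shift m v) - E *\<^sub>R shift m v
        = shift m (mathieu \<alpha> \<beta> (\<theta> + x) v - mathieu \<alpha> \<beta> \<theta> v)"
      unfolding \<theta>x mathieu_periodic mathieu_shift v(2) by simp
    have "norm (mathieu \<alpha> \<beta> \<theta> (shift m v) - E *\<^sub>R shift m v) \<le> 2 * \<bar>\<beta>\<bar> * \<bar>x\<bar> * norm v"
      unfolding eq norm_shift using norm_mathieu_diff[of \<alpha> \<beta> "\<theta> + x" v \<theta>] by simp
    also have "\<dots> \<le> 2 * \<bar>\<beta>\<bar> * \<eta> * norm v" using x by (intro mult_right_mono mult_left_mono) auto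
    finally show ?thesis by (simp add: mult_ac)
  qed
  from mult_left_mono[OF this L(1)]
  have small: "L * norm (mathieu \<alpha> \<beta> \<theta> (shift m v) - E *\<^sub>R shift m v) \<le> \<delta>"
  proof (rule order.trans)
    have "L * (2 * \<bar>\<beta>\<bar> * norm v * \<eta>) \<le> (L * (2 * \<bar>\<beta>\<bar> * norm v) + 1) * \<eta>"
      using \<open>\<eta> > 0\<close> by (simp add: algebra_simps)
    also have "\<dots> = \<delta>" using den by (simp add: \<eta>_def)
    finally show "L * (2 * \<bar>\<beta>\<bar> * norm v * \<eta>) \<le> \<delta>" .
  qed
  obtain l where l: "solves \<alpha> \<beta> \<theta> E l"
    "\<And>n. \<bar>l n - coord (shift m v) n\<bar> \<le> L * norm (mathieu \<alpha> \<beta> \<theta> (shift m v) - E *\<^sub>R shift m v)"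
    using L(2)[of "shift m v"] by blast
  have l': "\<bar>l n - \<xi> (n - m)\<bar> \<le> \<delta>" for n
    using order.trans[OF l(2)[of n] small] by (simp add: v(1))
  \<comment> \<open>The nearby solution \<open>l\<close> is a multiple of \<xi>. Its factor
    \<open>l 0\<close> is small, since the translated peak is far from 0, while \<open>l m\<close>
    is close to the peak value 1: a contradiction.\<close>
  have "l n = l 0 * \<xi> n" for n
  proof (rule solves_unique[OF _ l(1)])
    show "solves \<alpha> \<beta> \<theta> E \<xi>" "\<xi> 0 = 1" using loc by (auto simp: localized_def)
    show "(\<lambda>n. \<xi> (int n)) \<longlonglongrightarrow> 0" by (rule localized_tendsto_0[OF loc])
    show "\<bar>l n\<bar> \<le> k + \<delta>" for n using l'[of n] localized_le[OF loc, of "n - m"] by linarith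
  qed
  then have "l m = l 0 * \<xi> m" .
  moreover have "\<bar>l 0\<bar> < 2 * \<delta>"
  proof -
    have "\<bar>\<xi> (- m)\<bar> \<le> k * exp (- (1 / k) * real (nat m))"
      using loc \<open>m \<ge> 0\<close> unfolding localized_def by (auto dest!: spec[of _ "- m"])
    moreover have "nat m \<ge> M" using \<open>m \<ge> int M\<close> by linarith
    ultimately have "\<bar>\<xi> (- m)\<bar> < \<delta>" using M[of "nat m"] by linarith
    moreover have "\<bar>l 0 - \<xi> (- m)\<bar> \<le> \<delta>" using l'[of 0] by simp
    ultimately show ?thesis by linarith
  qed
  then have "\<bar>l 0\<bar> * \<bar>\<xi> m\<bar> \<le> 2 * \<delta> * k"
    by (intro mult_mono localized_le[OF loc]) (use k \<open>\<delta> > 0\<close> in auto)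
  moreover have "\<bar>l m - 1\<bar> \<le> \<delta>" using l'[of m] loc by (simp add: localized_def)
  ultimately have "1 - \<delta> \<le> 2 * \<delta> * k" by (simp add: abs_mult[symmetric])
  moreover have "\<delta> * (4 * (1 + real k)) = 1" using k by (simp add: \<delta>_def)
  ultimately show False using \<open>\<delta> > 0\<close> k by (simp add: algebra_simps)
qed

section \<open>Absolutely convergent Fourier series and quasiperiodic functions\<close>

definition trig :: "(int \<Rightarrow> complex) \<Rightarrow> real \<Rightarrow> complex" where
  "trig c x = (\<Sum>\<^sub>\<infinity>n. c n * cis (of_int n * x))"

lemma integral_cis_int:
  "integral {0..2 * pi} (\<lambda>x. cis (of_int k * x)) = (if k = 0 then complex_of_real (2 * pi) else 0)"
proof (cases "k = 0")
  case False
  have "integral {0..2 * pi} (\<lambda>x. exp (\<i> * of_int k * complex_of_real x))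
      = (exp (\<i> * of_int k * of_real (2 * pi)) - 1) / (\<i> * of_int k)"
    using False by (intro integral_exp) auto
  moreover have "exp (\<i> * of_int k * of_real (2 * pi)) = 1"
    using exp_integer_2pi[of "of_int k"] by (simp add: mult_ac)
  ultimately show ?thesis
    using False by (simp add: cis_conv_exp mult_ac)
qed (simp add: scaleR_conv_of_real)

context
  fixes c :: "int \<Rightarrow> complex"
  assumes c: "(\<lambda>n. norm (c n)) summable_on UNIV"
begin

lemma trig_has_sum: "((\<lambda>n. c n * cis (of_int n * x)) has_sum trig c x) UNIV"
  unfolding trig_def
  by (rule has_sum_infsum, rule abs_summable_summable) (use c in \<open>simp add: norm_mult\<close>)

lemma continuous_trig: "continuous_on UNIV (trig c)"
proof (rule uniform_limit_theorem)
  show "uniform_limit UNIV (\<lambda>X x. \<Sum>n\<in>X. c n * cis (of_int n * x)) (trig c) (finite_subsets_at_top UNIV)"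
    unfolding trig_def by (rule Weierstrass_m_test_general[OF _ c]) (simp add: norm_mult)
  show "\<forall>\<^sub>F X in finite_subsets_at_top UNIV. continuous_on UNIV (\<lambda>x. \<Sum>n\<in>X. c n * cis (of_int n * x))"
    by (intro always_eventually allI continuous_intros)
qed simp

lemma trig_periodic: "trig c (x + 2 * pi) = trig c x"
proof -
  have "cis (of_int n * (x + 2 * pi)) = cis (of_int n * x)" for n
    using cis_multiple_2pi[of "of_int n"] by (simp add: distrib_left cis_mult[symmetric] mult_ac)
  then show ?thesis by (simp add: trig_def)
qed

text \<open>Absolute summability gives uniform convergence, which permits termwise integration. The
  weight \<open>g\<close> is general because it is used twice: a character gives
  \<open>trig_coefficient\<close>, the conjugate wave gives the mean of the Wronskian in
  \<open>W_zero\<close>.\<close>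

lemma trig_integral_has_sum:
  assumes g: "continuous_on UNIV g"
  shows "((\<lambda>n. c n * integral {0..2 * pi} (\<lambda>x. g x * cis (of_int n * x))) has_sum
    integral {0..2 * pi} (\<lambda>x. g x * trig c x)) UNIV"
proof -
  have "compact (g ` {0..2 * pi})"
    by (intro compact_continuous_image continuous_on_subset[OF g]) auto
  then obtain B where B: "\<And>x. x \<in> {0..2 * pi} \<Longrightarrow> norm (g x) \<le> B"
    by (meson bounded_iff compact_imp_bounded imageI)
  have "uniform_limit {0..2 * pi} (\<lambda>X x. \<Sum>n\<in>X. g x * (c n * cis (of_int n * x)))
      (\<lambda>x. g x * trig c x) (finite_subsets_at_top UNIV)"
  proof (rule Weierstrass_m_test_general')
    show "norm (g x * (c n * cis (of_int n * x))) \<le> B * norm (c n)" if "x \<in> {0..2 * pi}" for n x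
      using B[OF that] by (simp add: norm_mult mult_right_mono)
    show "((\<lambda>n. g x * (c n * cis (of_int n * x))) has_sum g x * trig c x) UNIV" for x
      by (rule has_sum_cmult_right[OF trig_has_sum])
    show "(\<lambda>n. B * norm (c n)) summable_on UNIV" by (rule summable_on_cmult_right[OF c])
  qed
  moreover have cont: "continuous_on {0..2 * pi} (\<lambda>x. g x * (c n * cis (of_int n * x)))" for n
    by (intro continuous_intros continuous_on_subset[OF g]) auto
  then have "continuous_on {0..2 * pi} (\<lambda>x. \<Sum>n\<in>X. g x * (c n * cis (of_int n * x)))" for X
    by (intro continuous_on_sum)
  ultimately obtain I J where
    I: "\<And>X. ((\<lambda>x. \<Sum>n\<in>X. g x * (c n * cis (of_int n * x))) has_integral I X) {0..2 * pi}"
    and J: "((\<lambda>x. g x * trig c x) has_integral J) {0..2 * pi}"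
    and IJ: "(I \<longlongrightarrow> J) (finite_subsets_at_top UNIV)"
    by (rule uniform_limit_integral) auto
  have "I X = (\<Sum>n\<in>X. c n * integral {0..2 * pi} (\<lambda>x. g x * cis (of_int n * x)))" if "finite X" for X
  proof -
    have "I X = integral {0..2 * pi} (\<lambda>x. \<Sum>n\<in>X. g x * (c n * cis (of_int n * x)))"
      using I[of X] by (simp add: integral_unique)
    also have "\<dots> = (\<Sum>n\<in>X. integral {0..2 * pi} (\<lambda>x. g x * (c n * cis (of_int n * x))))"
      by (rule integral_sum[OF that]) (rule integrable_continuous_real[OF cont])
    also have "\<dots> = (\<Sum>n\<in>X. integral {0..2 * pi} (\<lambda>x. c n * (g x * cis (of_int n * x))))"
      by (simp add: mult_ac)
    finally show ?thesis by simp
  qed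
  then have "\<forall>\<^sub>F X in finite_subsets_at_top UNIV.
      I X = (\<Sum>n\<in>X. c n * integral {0..2 * pi} (\<lambda>x. g x * cis (of_int n * x)))"
    by (auto intro: eventually_mono[OF eventually_finite_subsets_at_top_weakI])
  with IJ show ?thesis
    unfolding has_sum_def integral_unique[OF J] by (rule Lim_transform_eventually)
qed

lemma trig_coefficient: "integral {0..2 * pi} (\<lambda>x. cis (- (of_int m * x)) * trig c x) = 2 * pi * c m"
proof -
  have "((\<lambda>n. c n * integral {0..2 * pi} (\<lambda>x. cis (- (of_int m * x)) * cis (of_int n * x))) has_sum
    integral {0..2 * pi} (\<lambda>x. cis (- (of_int m * x)) * trig c x)) UNIV"
    by (intro trig_integral_has_sum continuous_intros)
  moreover have "integral {0..2 * pi} (\<lambda>x. cis (- (of_int m * x)) * cis (of_int n * x))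
      = (if n = m then complex_of_real (2 * pi) else 0)" for n
    using integral_cis_int[of "n - m"] by (simp add: cis_mult algebra_simps)
  ultimately have "((\<lambda>n. c n * (if n = m then complex_of_real (2 * pi) else 0)) has_sum
    integral {0..2 * pi} (\<lambda>x. cis (- (of_int m * x)) * trig c x)) UNIV"
    by (simp only:)
  moreover have "((\<lambda>n. c n * (if n = m then complex_of_real (2 * pi) else 0)) has_sum 2 * pi * c m) UNIV"
    by (rule has_sum_finite_neutralI[of "{m}"]) auto
  ultimately show ?thesis by (rule has_sum_unique)
qed

end

section \<open>Dense orbits of the irrational rotation and winding numbers\<close>

lemma dense_orbit_closed:
  fixes S :: "real set"
  assumes "\<alpha> \<notin> \<rat>" "closed S" "\<And>k j. x + 2 * pi * \<alpha> * of_int k + 2 * pi * of_int j \<in> S"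
  shows "y \<in> S"
proof -
  have "\<exists>z\<in>S. dist z y < \<epsilon>" if \<epsilon>: "\<epsilon> > 0" for \<epsilon>
  proof -
    obtain k j :: int where "\<bar>2 * pi * \<alpha> * of_int k + 2 * pi * of_int j - (y - x)\<bar> < \<epsilon>"
      by (rule dense_rotation[OF assms(1) \<epsilon>])
    then show ?thesis
      by (intro bexI[OF _ assms(3)[of k j]]) (simp add: dist_real_def algebra_simps)
  qed
  then show ?thesis using assms(2) by (metis closure_approachable closure_closed)
qed

lemma orbit_invariant:
  fixes W :: "real \<Rightarrow> 'b"
  assumes "\<And>x. W (x + a) = W x"
  shows "W (x + a * of_int k) = W x"
proof (induction k rule: int_induct[where k = 0])
  case (step1 i)
  then show ?case using assms[of "x + a * of_int i"] by (simp add: algebra_simps)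
next
  case (step2 i)
  then show ?case using assms[of "x + a * of_int (i - 1)"] by (simp add: algebra_simps)
qed simp

lemma integer_valued_continuous_const:
  fixes h :: "real \<Rightarrow> real"
  assumes "continuous_on UNIV h" "\<And>x. \<exists>n::int. h x = 2 * pi * of_int n"
  shows "\<exists>n::int. \<forall>x. h x = 2 * pi * of_int n"
proof -
  have "h constant_on UNIV"
  proof (rule continuous_discrete_range_constant[OF connected_UNIV assms(1)])
    fix x :: real
    have "2 * pi \<le> norm (h y - h x)" if "h y \<noteq> h x" for y
    proof -
      obtain m n :: int where mn: "h y = 2 * pi * of_int m" "h x = 2 * pi * of_int n"
        using assms(2) by metis
      then have "1 \<le> \<bar>m - n\<bar>" using that by auto
      then have "1 \<le> \<bar>real_of_int m - real_of_int n\<bar>" by linarith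
      then have "2 * pi * 1 \<le> 2 * pi * \<bar>real_of_int m - real_of_int n\<bar>" by (intro mult_left_mono) auto
      also have "\<dots> = norm (h y - h x)" by (simp add: mn abs_mult flip: right_diff_distrib)
      finally show ?thesis by simp
    qed
    then show "\<exists>e>0. \<forall>y. y \<in> UNIV \<and> h y \<noteq> h x \<longrightarrow> e \<le> norm (h y - h x)"
      by (intro exI[of _ "2 * pi"]) auto
  qed
  then show ?thesis using assms(2) unfolding constant_on_def by (metis UNIV_I)
qed

text \<open>A continuous argument of \<open>c\<close> grows by 2 pi times the winding number
  \<open>d\<close> over a period. Subtracting \<open>d\<close> times x leaves a periodic, hence
  bounded, function that gains the same constant at every step \<omega>; boundedness forces that
  constant to be 0.\<close>

lemma unimodular_quasiperiodic:
  fixes c :: "real \<Rightarrow> complex"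
  assumes cont: "continuous_on UNIV c" and mod: "\<And>x. norm (c x) = 1"
    and per: "\<And>x. c (x + 2 * pi) = c x" and qper: "\<And>x. c (x + \<omega>) = cis (- \<tau>) * c x"
  obtains m d :: int where "\<tau> = 2 * pi * of_int m - \<omega> * of_int d"
proof -
  have "c x \<noteq> 0" for x using mod[of x] by auto
  then obtain g where g: "continuous_on UNIV g" "\<And>x. c x = exp (g x)"
    using continuous_logarithm_on_contractible[OF cont contractible_UNIV] by (metis UNIV_I)
  define \<phi> where "\<phi> = (\<lambda>x. Im (g x))"
  have \<phi>_cont: "continuous_on UNIV \<phi>" unfolding \<phi>_def by (intro continuous_intros g)
  have c: "c x = cis (\<phi> x)" for x
  proof -
    have "exp (Re (g x)) = 1" using mod[of x] by (simp add: g)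
    then show ?thesis by (simp add: g exp_eq_polar \<phi>_def)
  qed
  have shift_cont: "continuous_on UNIV (\<lambda>x. \<phi> (x + a))" for a
    by (rule continuous_on_compose2[OF \<phi>_cont]) (auto intro!: continuous_intros)
  have int: "\<exists>n::int. a - b = 2 * pi * of_int n" if "cis a = cis b" for a b
  proof -
    have "exp (\<i> * complex_of_real a) = exp (\<i> * complex_of_real b)" using that by (simp add: cis_conv_exp)
    then obtain n :: int where "\<i> * complex_of_real a = \<i> * complex_of_real b + (of_int (2 * n) * pi) * \<i>"
      unfolding exp_eq by auto
    then have "Im (\<i> * complex_of_real a) = Im (\<i> * complex_of_real b + (of_int (2 * n) * pi) * \<i>)" by simp
    then have "a = b + 2 * of_int n * pi" by simp
    then show ?thesis by (intro exI[of _ n]) simp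
  qed
  have "continuous_on UNIV (\<lambda>x. \<phi> (x + 2 * pi) - \<phi> x)"
    by (intro continuous_intros shift_cont \<phi>_cont)
  moreover have "\<exists>n::int. \<phi> (x + 2 * pi) - \<phi> x = 2 * pi * of_int n" for x
    using per[of x] by (intro int) (simp add: c)
  ultimately have "\<exists>d::int. \<forall>x. \<phi> (x + 2 * pi) - \<phi> x = 2 * pi * of_int d"
    by (rule integer_valued_continuous_const)
  then obtain d :: int where d: "\<And>x. \<phi> (x + 2 * pi) - \<phi> x = 2 * pi * of_int d" by blast
  have "continuous_on UNIV (\<lambda>x. \<phi> (x + \<omega>) - (\<phi> x - \<tau>))"
    by (intro continuous_intros shift_cont \<phi>_cont)
  moreover have "\<exists>n::int. \<phi> (x + \<omega>) - (\<phi> x - \<tau>) = 2 * pi * of_int n" for x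
    using qper[of x] by (intro int) (simp add: c cis_mult)
  ultimately have "\<exists>m::int. \<forall>x. \<phi> (x + \<omega>) - (\<phi> x - \<tau>) = 2 * pi * of_int m"
    by (rule integer_valued_continuous_const)
  then obtain m :: int where m: "\<And>x. \<phi> (x + \<omega>) - (\<phi> x - \<tau>) = 2 * pi * of_int m" by blast
  define \<psi> where "\<psi> = (\<lambda>x. \<phi> x - of_int d * x)"
  define \<delta> where "\<delta> = 2 * pi * of_int m - \<tau> - \<omega> * of_int d"
  have "\<psi> (x + 2 * pi) = \<psi> x" for x using d[of x] by (simp add: \<psi>_def algebra_simps)
  then have \<psi>_per: "\<psi> (x + 2 * pi * of_int j) = \<psi> x" for x j by (rule orbit_invariant)
  have \<psi>_shift: "\<psi> (x + \<omega>) = \<psi> x + \<delta>" for x using m[of x] by (simp add: \<psi>_def \<delta>_def algebra_simps)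
  have "continuous_on {0..2 * pi} \<psi>"
    unfolding \<psi>_def by (intro continuous_intros continuous_on_subset[OF \<phi>_cont]) auto
  then have "compact (\<psi> ` {0..2 * pi})" by (intro compact_continuous_image) auto
  then obtain B where B: "\<And>x. x \<in> {0..2 * pi} \<Longrightarrow> \<bar>\<psi> x\<bar> \<le> B"
    by (metis bounded_iff compact_imp_bounded imageI real_norm_def)
  have bdd: "\<bar>\<psi> x\<bar> \<le> B" for x
  proof -
    define j where "j = - \<lfloor>x / (2 * pi)\<rfloor>"
    have "x + 2 * pi * of_int j = 2 * pi * frac (x / (2 * pi))"
      by (simp add: j_def frac_def field_simps)
    then have "x + 2 * pi * of_int j \<in> {0..2 * pi}" using frac_lt_1[of "x / (2 * pi)"] by auto
    then show ?thesis using B[of "x + 2 * pi * of_int j"] \<psi>_per[of x j] by simp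
  qed
  have iter: "\<psi> (real n * \<omega>) = \<psi> 0 + real n * \<delta>" for n
  proof (induction n)
    case (Suc n)
    then show ?case using \<psi>_shift[of "real n * \<omega>"] by (simp add: algebra_simps)
  qed simp
  have "\<delta> = 0"
  proof (rule ccontr)
    assume "\<delta> \<noteq> 0"
    then obtain n where "2 * B < real n * \<bar>\<delta>\<bar>" using reals_Archimedean3[of "\<bar>\<delta>\<bar>"] by auto
    moreover have "real n * \<bar>\<delta>\<bar> = \<bar>\<psi> (real n * \<omega>) - \<psi> 0\<bar>" by (simp add: iter abs_mult)
    ultimately show False using bdd[of "real n * \<omega>"] bdd[of 0] by linarith
  qed
  then show ?thesis using that[of m d] by (simp add: \<delta>_def algebra_simps)
qed

section \<open>The dual Bloch wave and resonance\<close>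

locale localized_eigenvector =
  fixes \<alpha> \<beta> :: real and k :: nat and E \<theta> :: real and \<xi> :: "int \<Rightarrow> real"
  assumes irr: "\<alpha> \<notin> \<rat>" and loc: "localized \<alpha> \<beta> k E \<theta> \<xi>"
begin

definition \<omega> :: real where "\<omega> = 2 * pi * \<alpha>"

definition f :: "real \<Rightarrow> complex" where "f = trig (\<lambda>n. complex_of_real (\<xi> n))"

lemma coeff_summable: "(\<lambda>n. norm (complex_of_real (\<xi> n))) summable_on UNIV"
  using localized_summable[OF loc] by simp

lemmas f_has_sum = trig_has_sum[OF coeff_summable, folded f_def]
lemmas f_continuous = continuous_trig[OF coeff_summable, folded f_def]
lemmas f_periodic = trig_periodic[OF coeff_summable, folded f_def]
lemmas f_coefficient = trig_coefficient[OF coeff_summable, folded f_def]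

lemma f_nonzero: "\<exists>x. f x \<noteq> 0"
proof (rule ccontr)
  assume "\<not> ?thesis"
  then have "complex_of_real (2 * pi) * complex_of_real (\<xi> 0) = 0"
    using f_coefficient[of 0] by simp
  then show False using loc by (simp add: localized_def)
qed

text \<open>Aubry duality.\<close>

lemma dual_equation:
  "\<beta> * (cis \<theta> * f (x + \<omega>) + cis (- \<theta>) * f (x - \<omega>)) = complex_of_real (E - 2 * cos x) * f x"
proof -
  have cis_sum: "cis y + cis (- y) = complex_of_real (2 * cos y)" for y
    by (simp add: complex_eq_iff)
  \<comment> \<open>Summation against characters turns the two shifts into multiplication by 2 cos
    x, while the cosine potential, split into exponentials, becomes translation of \<open>f\<close>
    by \<omega> in both directions.\<close>
  have up: "((\<lambda>n. \<xi> (n + 1) * cis (of_int n * x)) has_sum cis (- x) * f x) UNIV"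
  proof -
    have b: "bij_betw (\<lambda>n::int. n + 1) UNIV UNIV"
      by (rule bij_betwI[where g = "\<lambda>n. n - 1"]) auto
    have "((\<lambda>n. \<xi> (n + 1) * cis (of_int (n + 1) * x)) has_sum f x) UNIV"
      using has_sum_reindex_bij_betw[OF b, of "\<lambda>n. \<xi> n * cis (of_int n * x)"] f_has_sum[of x] by simp
    moreover have "cis (- x) * (z * cis (of_int (n + 1) * x)) = z * cis (of_int n * x)" for z and n :: int
    proof -
      have "cis (- x) * cis (of_int (n + 1) * x) = cis (of_int n * x)"
        by (simp add: cis_mult algebra_simps)
      then show ?thesis by (metis mult.left_commute)
    qed
    ultimately show ?thesis
      using has_sum_cmult_right[of "\<lambda>n. \<xi> (n + 1) * cis (of_int (n + 1) * x)" UNIV "f x" "cis (- x)"]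
      by (simp only:)
  qed
  have down: "((\<lambda>n. \<xi> (n - 1) * cis (of_int n * x)) has_sum cis x * f x) UNIV"
  proof -
    have b: "bij_betw (\<lambda>n::int. n - 1) UNIV UNIV"
      by (rule bij_betwI[where g = "\<lambda>n. n + 1"]) auto
    have "((\<lambda>n. \<xi> (n - 1) * cis (of_int (n - 1) * x)) has_sum f x) UNIV"
      using has_sum_reindex_bij_betw[OF b, of "\<lambda>n. \<xi> n * cis (of_int n * x)"] f_has_sum[of x] by simp
    moreover have "cis x * (z * cis (of_int (n - 1) * x)) = z * cis (of_int n * x)" for z and n :: int
    proof -
      have "cis x * cis (of_int (n - 1) * x) = cis (of_int n * x)"
        by (simp add: cis_mult algebra_simps)
      then show ?thesis by (metis mult.left_commute)
    qed
    ultimately show ?thesis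
      using has_sum_cmult_right[of "\<lambda>n. \<xi> (n - 1) * cis (of_int (n - 1) * x)" UNIV "f x" "cis x"]
      by (simp only:)
  qed
  have pot: "((\<lambda>n. \<beta> * (cis \<theta> * (\<xi> n * cis (of_int n * (x + \<omega>)))
        + cis (- \<theta>) * (\<xi> n * cis (of_int n * (x - \<omega>)))))
      has_sum \<beta> * (cis \<theta> * f (x + \<omega>) + cis (- \<theta>) * f (x - \<omega>))) UNIV"
    by (intro has_sum_cmult_right has_sum_add f_has_sum)
  have pot_eq: "\<beta> * (cis \<theta> * (\<xi> n * cis (of_int n * (x + \<omega>))) + cis (- \<theta>) * (\<xi> n * cis (of_int n * (x - \<omega>))))
      = complex_of_real (2 * \<beta> * cos (2 * pi * \<alpha> * of_int n + \<theta>) * \<xi> n) * cis (of_int n * x)" for n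
  proof -
    let ?y = "2 * pi * \<alpha> * of_int n + \<theta>"
    have "cis \<theta> * cis (of_int n * (x + \<omega>)) = cis ?y * cis (of_int n * x)"
      "cis (- \<theta>) * cis (of_int n * (x - \<omega>)) = cis (- ?y) * cis (of_int n * x)"
      by (simp_all add: cis_mult \<omega>_def algebra_simps)
    then have "cis \<theta> * cis (of_int n * (x + \<omega>)) + cis (- \<theta>) * cis (of_int n * (x - \<omega>))
        = complex_of_real (2 * cos ?y) * cis (of_int n * x)"
      by (simp only: distrib_right[symmetric] cis_sum)
    then have "\<beta> * \<xi> n * (cis \<theta> * cis (of_int n * (x + \<omega>)) + cis (- \<theta>) * cis (of_int n * (x - \<omega>)))
        = \<beta> * \<xi> n * (complex_of_real (2 * cos ?y) * cis (of_int n * x))"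
      by simp
    then show ?thesis by (simp add: algebra_simps)
  qed
  have "((\<lambda>n. \<xi> (n + 1) * cis (of_int n * x) + \<xi> (n - 1) * cis (of_int n * x) +
      complex_of_real (2 * \<beta> * cos (2 * pi * \<alpha> * of_int n + \<theta>) * \<xi> n) * cis (of_int n * x))
    has_sum cis (- x) * f x + cis x * f x + \<beta> * (cis \<theta> * f (x + \<omega>) + cis (- \<theta>) * f (x - \<omega>))) UNIV"
    by (intro has_sum_add up down pot[unfolded pot_eq])
  moreover have "\<xi> (n + 1) * cis (of_int n * x) + \<xi> (n - 1) * cis (of_int n * x) +
      complex_of_real (2 * \<beta> * cos (2 * pi * \<alpha> * of_int n + \<theta>) * \<xi> n) * cis (of_int n * x)
      = E * (\<xi> n * cis (of_int n * x))" for n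
  proof -
    have "\<xi> (n + 1) + \<xi> (n - 1) + 2 * \<beta> * cos (2 * pi * \<alpha> * of_int n + \<theta>) * \<xi> n = E * \<xi> n"
      using loc by (simp add: localized_def solves_def)
    from arg_cong[OF this, of "\<lambda>r. complex_of_real r * cis (of_int n * x)"] show ?thesis
      by (simp add: algebra_simps)
  qed
  ultimately have "((\<lambda>n. E * (\<xi> n * cis (of_int n * x))) has_sum
      cis (- x) * f x + cis x * f x + \<beta> * (cis \<theta> * f (x + \<omega>) + cis (- \<theta>) * f (x - \<omega>))) UNIV"
    by (simp only:)
  moreover have "((\<lambda>n. E * (\<xi> n * cis (of_int n * x))) has_sum E * f x) UNIV"
    by (intro has_sum_cmult_right f_has_sum)
  ultimately have "cis (- x) * f x + cis x * f x + \<beta> * (cis \<theta> * f (x + \<omega>) + cis (- \<theta>) * f (x - \<omega>)) = E * f x"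
    by (rule has_sum_unique)
  moreover have "cis (- x) * f x + cis x * f x = complex_of_real (2 * cos x) * f x"
    using cis_sum[of x] by (metis add.commute distrib_right)
  ultimately have "complex_of_real (2 * cos x) * f x + \<beta> * (cis \<theta> * f (x + \<omega>) + cis (- \<theta>) * f (x - \<omega>))
      = E * f x"
    by (simp only:)
  then show ?thesis
    unfolding of_real_diff left_diff_distrib by (metis add_diff_cancel_left')
qed

text \<open>With \<beta> = 0 the dual equation forces E = 2 cos x wherever \<open>f\<close> is
  nonzero, but that set is open and nonempty, and the cosine is not constant on any
  interval.\<close>

lemma coupling_nonzero: "\<beta> \<noteq> 0"
proof
  assume "\<beta> = 0"
  have zero: "E = 2 * cos x" if "f x \<noteq> 0" for x
  proof -
    have "complex_of_real (E - 2 * cos x) * f x = 0"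
      using dual_equation[of x] \<open>\<beta> = 0\<close> by (metis mult_zero_left of_real_0)
    then show ?thesis using that unfolding mult_eq_0_iff of_real_eq_0_iff by simp
  qed
  obtain x where "f x \<noteq> 0" using f_nonzero by blast
  then have mem: "x \<in> {x. f x \<noteq> 0}" by simp
  have "open {x. f x \<noteq> 0}"
    by (rule open_Collect_neq[OF f_continuous continuous_on_const])
  from openE[OF this mem] obtain e where e: "e > 0" "ball x e \<subseteq> {x. f x \<noteq> 0}" .
  define t where "t = min (e / 2) 1"
  have t: "t > 0" "t < e" "t < pi" using e(1) pi_gt3 by (auto simp: t_def)
  have nz: "f (x + t) \<noteq> 0" "f (x - t) \<noteq> 0"
    using subsetD[OF e(2), of "x + t"] subsetD[OF e(2), of "x - t"] t by (auto simp: dist_real_def)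
  have eq: "cos (x + t) = cos x" "cos (x - t) = cos x"
    using zero[OF nz(1)] zero[OF nz(2)] zero[OF \<open>f x \<noteq> 0\<close>] by auto
  then have cs: "cos x * cos t = cos x" "sin x * sin t = 0"
    unfolding cos_add cos_diff by linarith+
  have "sin t > 0" using sin_gt_zero[of t] t by simp
  with cs(2) have "sin x = 0" by simp
  have "cos t < 1"
    using cos_monotone_0_pi[of 0 t] t by simp
  with cs(1) have "cos x = 0" by simp
  with \<open>sin x = 0\<close> show False using sin_zero_abs_cos_one by fastforce
qed

text \<open>Two consecutive zeros spread along the whole orbit by the three-term dual equation, and
  density would make \<open>f\<close> vanish identically. This protects the denominator in
  \<open>resonance\<close>.\<close>

lemma f_zero_pair: "f x \<noteq> 0 \<or> f (x + \<omega>) \<noteq> 0"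
proof (rule ccontr)
  assume "\<not> ?thesis"
  then have z: "f x = 0" "f (x + \<omega>) = 0" by auto
  have orbit: "f (x + \<omega> * of_int n) = 0 \<and> f (x + \<omega> * of_int (n + 1)) = 0" for n
  proof (induction n rule: int_induct[where k = 0])
    case (step1 i)
    have "\<beta> * (cis \<theta> * f (x + \<omega> * of_int (i + 1) + \<omega>) + cis (- \<theta>) * f (x + \<omega> * of_int i)) = 0"
      using dual_equation[of "x + \<omega> * of_int (i + 1)"] step1 by (simp add: algebra_simps)
    then have "f (x + \<omega> * of_int (i + 1) + \<omega>) = 0" using step1 coupling_nonzero by simp
    then show ?case using step1 by (simp add: algebra_simps)
  next
    case (step2 i)
    have "\<beta> * (cis \<theta> * f (x + \<omega> * of_int (i + 1)) + cis (- \<theta>) * f (x + \<omega> * of_int i - \<omega>)) = 0"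
      using dual_equation[of "x + \<omega> * of_int i"] step2 by (simp add: algebra_simps)
    then have "f (x + \<omega> * of_int i - \<omega>) = 0" using step2 coupling_nonzero by simp
    then show ?case using step2 by (simp add: algebra_simps)
  qed (use z in simp)
  have "y \<in> {x. f x = 0}" for y
  proof (rule dense_orbit_closed[OF irr, of _ x])
    show "closed {x. f x = 0}"
      by (rule closed_Collect_eq[OF f_continuous continuous_on_const])
    show "x + 2 * pi * \<alpha> * of_int m + 2 * pi * of_int j \<in> {x. f x = 0}" for m j
      using orbit_invariant[of f "2 * pi" "x + \<omega> * of_int m" j] orbit[of m] f_periodic
      by (simp add: \<omega>_def)
  qed
  then show False using f_nonzero by auto
qed

text \<open>Up to a constant factor, the Wronskian of the sequence
  \<open>cis (n * \<theta>) * f (x + n * \<omega>)\<close> with its conjugate. The factor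
  \<open>cis \<theta>\<close> absorbs the Bloch phase, so that the sequence obeys a recursion with
  real coefficients.\<close>

definition W :: "real \<Rightarrow> real" where "W x = Im (cnj (f x) * (cis \<theta> * f (x + \<omega>)))"

lemma f_shift_continuous: "continuous_on UNIV (\<lambda>x. f (x + a))"
  by (rule continuous_on_compose2[OF f_continuous]) (auto intro!: continuous_intros)

lemma W_continuous: "continuous_on UNIV W"
  unfolding W_def by (intro continuous_intros f_continuous f_shift_continuous)

text \<open>The coefficient \<open>E - 2 * cos x\<close> of the dual equation is real, so the
  Wronskian is conserved under translation by \<omega>. It is also 2 pi periodic and continuous, and
  the orbit is dense.\<close>

lemma W_const: "W x = W y"
proof -
  have step: "W (x + \<omega>) = W x" for x
  proof -
    define y where "y = x + \<omega>"
    have "cnj (f y) * (\<beta> * (cis \<theta> * f (y + \<omega>) + cis (- \<theta>) * f (y - \<omega>)))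
        = complex_of_real (E - 2 * cos y) * (f y * cnj (f y))"
      unfolding dual_equation by simp
    also have "\<dots> = complex_of_real ((E - 2 * cos y) * (cmod (f y))\<^sup>2)"
      by (simp only: of_real_mult complex_norm_square)
    finally have "Im (cnj (f y) * (\<beta> * (cis \<theta> * f (y + \<omega>) + cis (- \<theta>) * f (y - \<omega>)))) = 0"
      by simp
    moreover have "cnj (f y) * (\<beta> * (cis \<theta> * f (y + \<omega>) + cis (- \<theta>) * f (y - \<omega>)))
        = complex_of_real \<beta> * (cnj (f y) * (cis \<theta> * f (y + \<omega>)) + cnj (cnj (f (y - \<omega>)) * (cis \<theta> * f y)))"
      by (simp add: algebra_simps cis_cnj)
    moreover have "Im (complex_of_real \<beta> * (A + cnj B)) = \<beta> * (Im A - Im B)" for A B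
      by (simp add: algebra_simps)
    ultimately have "\<beta> * (Im (cnj (f y) * (cis \<theta> * f (y + \<omega>))) - Im (cnj (f (y - \<omega>)) * (cis \<theta> * f y))) = 0"
      by (simp only:)
    then show ?thesis using coupling_nonzero by (simp add: W_def y_def)
  qed
  have per: "W (x + 2 * pi) = W x" for x
    using f_periodic[of x] f_periodic[of "x + \<omega>"] by (simp add: W_def algebra_simps)
  have "x \<in> {z. W z = W y}"
  proof (rule dense_orbit_closed[OF irr, of _ y])
    show "closed {z. W z = W y}"
      by (rule closed_Collect_eq[OF W_continuous continuous_on_const])
    show "y + 2 * pi * \<alpha> * of_int m + 2 * pi * of_int j \<in> {z. W z = W y}" for m j
      using orbit_invariant[of W "2 * pi" "y + \<omega> * of_int m" j, OF per] orbit_invariant[of W \<omega> y m, OF step]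
      by (simp add: \<omega>_def)
  qed
  then show ?thesis by simp
qed

text \<open>By Parseval the integral of \<open>W\<close> over a period is 2 pi times the sum of
  \<open>(\<xi> n)\<^sup>2 * sin (\<omega> * n + \<theta>)\<close>, which is the form assumed to
  vanish; a constant equals its mean.\<close>

lemma W_zero:
  assumes v: "coord v = \<xi>" and s: "v \<bullet> cos_mult (2 * pi * \<alpha>) (\<theta> - pi / 2) v = 0"
  shows "W x = 0"
proof -
  define c where "c = (\<lambda>n. complex_of_real (\<xi> n) * cis (of_int n * \<omega>))"
  have c: "(\<lambda>n. norm (c n)) summable_on UNIV"
    using coeff_summable by (simp add: c_def norm_mult)
  have f_c: "f (x + \<omega>) = trig c x" for x
    by (simp add: f_def trig_def c_def distrib_left cis_mult[symmetric] mult_ac)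
  have g: "continuous_on UNIV (\<lambda>x. cnj (f x) * cis \<theta>)"
    by (intro continuous_intros f_continuous)
  have int: "integral {0..2 * pi} (\<lambda>x. cnj (f x) * cis \<theta> * cis (of_int n * x)) = cis \<theta> * (2 * pi * \<xi> n)" for n
  proof -
    have "integral {0..2 * pi} (\<lambda>x. cnj (f x) * cis \<theta> * cis (of_int n * x))
        = integral {0..2 * pi} (\<lambda>x. cis \<theta> * cnj (cis (- (of_int n * x)) * f x))"
      by (simp add: cis_cnj mult_ac)
    also have "\<dots> = cis \<theta> * cnj (integral {0..2 * pi} (\<lambda>x. cis (- (of_int n * x)) * f x))"
      by (simp only: integral_mult_right integral_cnj)
    also have "\<dots> = cis \<theta> * (2 * pi * \<xi> n)" by (simp add: f_coefficient)
    finally show ?thesis .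
  qed
  have "((\<lambda>n. c n * (cis \<theta> * (2 * pi * \<xi> n))) has_sum
      integral {0..2 * pi} (\<lambda>x. cnj (f x) * cis \<theta> * f (x + \<omega>))) UNIV"
    using trig_integral_has_sum[OF c g] by (simp only: int f_c)
  from has_sum_Im[OF this]
  have "((\<lambda>n. Im (c n * (cis \<theta> * (2 * pi * \<xi> n)))) has_sum
      Im (integral {0..2 * pi} (\<lambda>x. cnj (f x) * cis \<theta> * f (x + \<omega>)))) UNIV" .
  moreover have "Im (c n * (cis \<theta> * (2 * pi * \<xi> n)))
      = 2 * pi * (coord v n * coord (cos_mult (2 * pi * \<alpha>) (\<theta> - pi / 2) v) n)" for n
  proof -
    have eq: "c n * (cis \<theta> * (2 * pi * \<xi> n)) = complex_of_real (2 * pi * (\<xi> n * \<xi> n)) * cis (\<omega> * of_int n + \<theta>)"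
      by (simp add: c_def cis_mult[symmetric] mult_ac)
    have "cos (2 * pi * \<alpha> * of_int n + (\<theta> - pi / 2)) = sin (\<omega> * of_int n + \<theta>)"
      using cos_diff[of "\<omega> * of_int n + \<theta>" "pi / 2"] by (simp add: algebra_simps \<omega>_def)
    moreover have "Im (c n * (cis \<theta> * (2 * pi * \<xi> n))) = 2 * pi * (\<xi> n * \<xi> n) * sin (\<omega> * of_int n + \<theta>)"
      unfolding eq by simp
    ultimately show ?thesis by (simp add: v)
  qed
  ultimately have "Im (integral {0..2 * pi} (\<lambda>x. cnj (f x) * cis \<theta> * f (x + \<omega>)))
      = (\<Sum>\<^sub>\<infinity>n. 2 * pi * (coord v n * coord (cos_mult (2 * pi * \<alpha>) (\<theta> - pi / 2) v) n))"
    by (simp add: infsumI)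
  also have "\<dots> = 0"
    using s by (simp add: infsum_cmult_right' inner_sq del: coord_cos_mult)
  finally have zero: "Im (integral {0..2 * pi} (\<lambda>x. cnj (f x) * cis \<theta> * f (x + \<omega>))) = 0" .
  have "(\<lambda>x. cnj (f x) * cis \<theta> * f (x + \<omega>)) integrable_on {0..2 * pi}"
    by (intro integrable_continuous_real continuous_on_subset[of UNIV _ "{0..2 * pi}"]
        continuous_on_mult[OF g f_shift_continuous]) simp
  from has_integral_Im[OF integrable_integral[OF this]]
  have "((\<lambda>x. Im (cnj (f x) * cis \<theta> * f (x + \<omega>))) has_integral 0) {0..2 * pi}"
    by (simp only: zero)
  moreover have "Im (cnj (f y) * cis \<theta> * f (y + \<omega>)) = W x" for y
    using W_const[of y x] by (simp only: W_def mult.assoc)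
  ultimately have "((\<lambda>y. W x) has_integral 0) {0..2 * pi}"
    by (simp only:)
  moreover have "((\<lambda>y. W x) has_integral (2 * pi) * W x) {0..2 * pi}"
    using has_integral_const_real[of "W x" 0 "2 * pi"] by simp
  ultimately have "2 * pi * W x = 0" by (metis has_integral_unique)
  then show ?thesis by simp
qed

text \<open>Zero Wronskian makes \<open>f\<close> and its twisted translate \<open>u\<close> real
  multiples of one direction, determined only up to sign. Its square \<open>c\<close> is well
  defined and continuous through the zeros of \<open>f\<close>, since \<open>f\<close> and
  \<open>u\<close> never vanish together. Translation by \<omega> multiplies it by
  \<open>cis (- (2 * \<theta>))\<close>, and the winding argument applies.\<close>

lemma resonance:
  assumes W: "\<And>x. W x = 0"
  obtains m d :: int where "2 * \<theta> = 2 * pi * of_int m - 2 * pi * \<alpha> * of_int d"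
proof -
  define u where "u = (\<lambda>x. cis \<theta> * f (x + \<omega>))"
  define N where "N = (\<lambda>x. f x * cnj (f x) + u x * cnj (u x))"
  \<comment> \<open>the common value of \<open>f x / cnj (f x)\<close> and \<open>u x / cnj (u x)\<close>, also defined where one of them is \<open>0/0\<close>\<close>
  define c where "c = (\<lambda>x. ((f x)\<^sup>2 + (u x)\<^sup>2) / N x)"
  have N_eq: "N x = complex_of_real ((cmod (f x))\<^sup>2 + (cmod (u x))\<^sup>2)" for x
    by (simp only: N_def of_real_add complex_norm_square)
  have cmod_u: "cmod (u x) = cmod (f (x + \<omega>))" for x by (simp add: u_def norm_mult)
  have nz: "f x \<noteq> 0 \<or> u x \<noteq> 0" for x
    using f_zero_pair[of x] cmod_u[of x] by force
  have N: "N x \<noteq> 0" for x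
  proof -
    have "(cmod (f x))\<^sup>2 + (cmod (u x))\<^sup>2 \<noteq> 0"
      using nz[of x] by (simp add: sum_power2_eq_zero_iff)
    then show ?thesis unfolding N_eq by (simp only: of_real_eq_0_iff not_False_eq_True)
  qed
  have h: "cnj (f x) * u x = cnj (u x) * f x" for x
  proof -
    have "Im (cnj (f x) * u x) = 0" using W[of x] by (simp add: W_def u_def)
    then have "cnj (cnj (f x) * u x) = cnj (f x) * u x" by (simp add: complex_eq_iff)
    then show ?thesis by (simp add: mult.commute)
  qed
  have c_f: "f x = c x * cnj (f x)" for x
  proof -
    have "f x * N x = ((f x)\<^sup>2 + (u x)\<^sup>2) * cnj (f x)"
      using h[of x] unfolding N_def by algebra
    then show ?thesis using N[of x] by (simp add: c_def field_simps)
  qed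
  have c_u: "u x = c x * cnj (u x)" for x
  proof -
    have "u x * N x = ((f x)\<^sup>2 + (u x)\<^sup>2) * cnj (u x)"
      using h[of x] unfolding N_def by algebra
    then show ?thesis using N[of x] by (simp add: c_def field_simps)
  qed
  have mod: "cmod (c x) = 1" for x
  proof -
    have "cmod (f x) = cmod (c x) * cmod (f x)" "cmod (u x) = cmod (c x) * cmod (u x)"
      using arg_cong[OF c_f[of x], of cmod] arg_cong[OF c_u[of x], of cmod] by (simp_all add: norm_mult)
    then show ?thesis using nz[of x] by auto
  qed
  have u_cont: "continuous_on UNIV u"
    unfolding u_def by (intro continuous_intros f_shift_continuous)
  have c_cont: "continuous_on UNIV c"
    unfolding c_def using N unfolding N_def by (intro continuous_intros f_continuous u_cont) auto
  have c_per: "c (x + 2 * pi) = c x" for x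
    using f_periodic[of x] f_periodic[of "x + \<omega>"] by (simp add: c_def N_def u_def algebra_simps)
  have c_qper: "c (x + \<omega>) = cis (- (2 * \<theta>)) * c x" for x
  proof -
    define r where "r = (E - 2 * cos (x + \<omega>)) / \<beta>"
    \<comment> \<open>The next term of the twisted sequence after \<open>f x\<close> and
      \<open>u x\<close>. The recursion writes it as a real combination of these two, so it inherits
      their common direction.\<close>
    define w where "w = cis \<theta> * u (x + \<omega>)"
    have "\<beta> * (cis \<theta> * f (x + \<omega> + \<omega>) + cis (- \<theta>) * f x) = complex_of_real (E - 2 * cos (x + \<omega>)) * f (x + \<omega>)"
      using dual_equation[of "x + \<omega>"] by simp
    then have "u (x + \<omega>) + cis (- \<theta>) * f x = complex_of_real r * f (x + \<omega>)"
      using coupling_nonzero by (simp add: r_def u_def field_simps)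
    then have "cis \<theta> * (u (x + \<omega>) + cis (- \<theta>) * f x) = cis \<theta> * (complex_of_real r * f (x + \<omega>))"
      by simp
    moreover have "cis \<theta> * (cis (- \<theta>) * f x) = f x" by (simp add: mult.assoc[symmetric] cis_mult)
    ultimately have "w + f x = complex_of_real r * u x" by (simp add: w_def u_def algebra_simps)
    then have w: "w = complex_of_real r * u x - f x" by (simp add: algebra_simps)
    have "cnj w = complex_of_real r * cnj (u x) - cnj (f x)" by (simp add: w)
    then have c_w: "w = c x * cnj w"
      using c_f[of x] c_u[of x] w by algebra
    have rot: "cis (- \<theta>) * (c x * cnj z) = cis (- (2 * \<theta>)) * c x * cnj (cis (- \<theta>) * z)" for z
    proof -
      have "cis (- (2 * \<theta>)) * c x * cnj (cis (- \<theta>) * z) = (cis (- (2 * \<theta>)) * cis \<theta>) * (c x * cnj z)"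
        unfolding complex_cnj_mult cis_cnj by (simp only: minus_minus mult_ac)
      also have "cis (- (2 * \<theta>)) * cis \<theta> = cis (- \<theta>)" by (simp add: cis_mult)
      finally show ?thesis by (rule sym)
    qed
    have f_u: "f (x + \<omega>) = cis (- \<theta>) * u x" by (simp add: u_def mult.assoc[symmetric] cis_mult)
    have u_w: "u (x + \<omega>) = cis (- \<theta>) * w" by (simp add: w_def mult.assoc[symmetric] cis_mult)
    have "f (x + \<omega>) = cis (- (2 * \<theta>)) * c x * cnj (f (x + \<omega>))"
      unfolding f_u rot[symmetric] using c_u[of x] by simp
    moreover have "u (x + \<omega>) = cis (- (2 * \<theta>)) * c x * cnj (u (x + \<omega>))"
      unfolding u_w rot[symmetric] using c_w by simp
    ultimately show ?thesis
      using c_f[of "x + \<omega>"] c_u[of "x + \<omega>"] nz[of "x + \<omega>"]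
      by (metis complex_cnj_zero_iff mult_right_cancel)
  qed
  obtain m d :: int where "2 * \<theta> = 2 * pi * of_int m - \<omega> * of_int d"
    by (rule unimodular_quasiperiodic[OF c_cont mod c_per c_qper])
  then show ?thesis using that by (simp add: \<omega>_def)
qed

text \<open>Resonance makes the potential invariant under the reflection sending n to d - n, so the
  reflected eigenvector is \<xi> or its negative. Hence \<xi> has absolute value 1 at
  \<open>d\<close> as well as at 0, and the exponential envelope limits \<open>d\<close>.\<close>

lemma resonance_bounded:
  assumes res: "2 * \<theta> = 2 * pi * of_int m - 2 * pi * \<alpha> * of_int d"
  shows "\<bar>real_of_int d\<bar> \<le> real k * real k"
proof -
  have sol: "solves \<alpha> \<beta> \<theta> E (\<lambda>n. \<xi> (d - n))"
    unfolding solves_def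
  proof
    fix n
    have "2 * pi * \<alpha> * of_int (d - n) + \<theta> = - (2 * pi * \<alpha> * of_int n + \<theta>) + 2 * pi * of_int m"
      using res by (simp add: algebra_simps)
    also have "cos \<dots> = cos (2 * pi * \<alpha> * of_int n + \<theta>)"
    proof -
      have "cos (- y + 2 * pi * of_int m) = cos y" for y
        using cos.plus_of_int[of "- y" m] by (simp add: algebra_simps)
      then show ?thesis .
    qed
    finally have C: "cos (2 * pi * \<alpha> * of_int (d - n) + \<theta>) = cos (2 * pi * \<alpha> * of_int n + \<theta>)" .
    have eq: "\<xi> (d - n + 1) + \<xi> (d - n - 1) + 2 * \<beta> * cos (2 * pi * \<alpha> * of_int (d - n) + \<theta>) * \<xi> (d - n) = E * \<xi> (d - n)"
      using loc unfolding localized_def solves_def by blast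
    have "d - (n + 1) = d - n - 1" "d - (n - 1) = d - n + 1" by auto
    then show "\<xi> (d - (n + 1)) + \<xi> (d - (n - 1)) + 2 * \<beta> * cos (2 * pi * \<alpha> * of_int n + \<theta>) * \<xi> (d - n)
        = E * \<xi> (d - n)"
      using eq[unfolded C] by (simp only: add.commute)
  qed
  have \<xi>: "solves \<alpha> \<beta> \<theta> E \<xi>" "\<xi> 0 = 1" using loc by (auto simp: localized_def)
  have "\<xi> (d - d) = \<xi> (d - 0) * \<xi> d"
    by (rule solves_unique[OF \<xi>(1) sol \<xi>(2) localized_tendsto_0[OF loc] localized_le[OF loc]])
  then have "\<xi> d * \<xi> d = 1" by (simp add: \<xi>(2))
  then have "\<bar>\<xi> d\<bar> = 1" by (auto simp: square_eq_1_iff)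
  moreover have "\<bar>\<xi> d\<bar> \<le> k * exp (- \<bar>real_of_int d\<bar> / k)" using loc by (simp add: localized_def)
  ultimately have "1 * exp (\<bar>real_of_int d\<bar> / k) \<le> k * exp (- \<bar>real_of_int d\<bar> / k) * exp (\<bar>real_of_int d\<bar> / k)"
    by (intro mult_right_mono) auto
  also have "\<dots> = k" by (simp add: mult.assoc flip: exp_add)
  \<comment> \<open>The crude estimate of the exponential by its tangent line already yields the
    bound \<open>k * k\<close>.\<close>
  finally have "1 + \<bar>real_of_int d\<bar> / k \<le> k"
    using exp_ge_add_one_self[of "\<bar>real_of_int d\<bar> / k"] by linarith
  then have "\<bar>real_of_int d\<bar> / k \<le> k" by linarith
  then show ?thesis using localized_pos[OF loc] by (simp add: field_simps)
qed

end

section \<open>Uniform localization\<close>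

lemma localized_resonance_at_gap_edge:
  assumes irr: "\<alpha> \<notin> \<rat>" and loc: "localized \<alpha> \<beta> k E \<theta> \<xi>" and "e > 0"
    and gap: "{E<..<E + e} \<inter> ap_spec \<alpha> \<beta> = {} \<or> {E - e<..<E} \<inter> ap_spec \<alpha> \<beta> = {}"
  shows "\<exists>m d :: int. 2 * \<theta> = 2 * pi * of_int m - 2 * pi * \<alpha> * of_int d \<and> \<bar>real_of_int d\<bar> \<le> real k * real k"
proof -
  interpret localized_eigenvector \<alpha> \<beta> k E \<theta> \<xi>
    by standard (fact irr, fact loc)
  obtain v where v: "coord v = \<xi>" "mathieu \<alpha> \<beta> \<theta> v = E *\<^sub>R v"
    by (rule localized_vector[OF loc])
  have "v \<bullet> cos_mult (2 * pi * \<alpha>) (\<theta> - pi / 2) v = 0"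
    using phase_derivative_zero_at_gap_edge[OF irr v(2) \<open>e > 0\<close> gap] coupling_nonzero by simp
  from W_zero[OF v(1) this] obtain m d :: int
    where "2 * \<theta> = 2 * pi * of_int m - 2 * pi * \<alpha> * of_int d"
    by (rule resonance)
  with resonance_bounded[OF this] show ?thesis by blast
qed

lemma finite_resonant_phases:
  "finite {\<theta> \<in> {0..2 * pi}. \<exists>m d :: int. 2 * \<theta> = 2 * pi * of_int m - 2 * pi * \<alpha> * of_int d \<and> \<bar>real_of_int d\<bar> \<le> R}"
proof -
  \<comment> \<open>Resonance gives \<open>\<theta> = pi * (m - \<alpha> * d)\<close>, so a phase in
    the interval forces m - \<alpha> d between 0 and 2.\<close>
  define M where "M = 2 + \<bar>\<alpha>\<bar> * R"
  have fin: "finite {m::int. \<bar>real_of_int m\<bar> \<le> B}" for B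
  proof (rule finite_subset)
    show "{m::int. \<bar>real_of_int m\<bar> \<le> B} \<subseteq> {- \<lceil>B\<rceil>..\<lceil>B\<rceil>}"
    proof
      fix m :: int assume "m \<in> {m. \<bar>real_of_int m\<bar> \<le> B}"
      then have "m \<le> \<lceil>B\<rceil>" "- m \<le> \<lceil>B\<rceil>" by (auto simp: le_ceiling_iff)
      then show "m \<in> {- \<lceil>B\<rceil>..\<lceil>B\<rceil>}" by auto
    qed
  qed simp
  have "\<theta> \<in> (\<lambda>(m, d). pi * of_int m - pi * \<alpha> * of_int d) ` ({m. \<bar>real_of_int m\<bar> \<le> M} \<times> {d. \<bar>real_of_int d\<bar> \<le> R})"
    if \<theta>: "\<theta> \<in> {0..2 * pi}" and eq: "2 * \<theta> = 2 * pi * of_int m - 2 * pi * \<alpha> * of_int d"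
      and d: "\<bar>real_of_int d\<bar> \<le> R" for \<theta> and m d :: int
  proof -
    have "\<theta> = pi * (of_int m - \<alpha> * of_int d)" using eq by (simp add: algebra_simps)
    moreover have "0 \<le> \<theta>" "\<theta> \<le> pi * 2" using \<theta> by auto
    ultimately have "0 \<le> of_int m - \<alpha> * of_int d" "of_int m - \<alpha> * of_int d \<le> 2"
      using pi_gt_zero by (auto simp: zero_le_mult_iff)
    moreover have "\<bar>\<alpha> * of_int d\<bar> \<le> \<bar>\<alpha>\<bar> * R" unfolding abs_mult by (rule mult_left_mono[OF d]) simp
    ultimately have "\<bar>real_of_int m\<bar> \<le> M" by (simp add: M_def abs_le_iff)
    with d eq show ?thesis by (intro image_eqI[of _ _ "(m, d)"]) auto
  qed
  then show ?thesis
    by (intro finite_subset[OF _ finite_imageI[OF finite_cartesian_product[OF fin[of M] fin[of R]]]]) blast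
qed

text \<open>Eigenvectors for distinct energies are orthogonal; this is Bessel's inequality for the coordinate
  functional at \<open>0\<close>.\<close>

lemma finite_localized_energies:
  assumes "finite A" "\<And>E. E \<in> A \<Longrightarrow> \<exists>\<xi>. localized \<alpha> \<beta> k E \<theta> \<xi>"
  shows "real (card A) \<le> localization_norm k"
proof (cases "A = {}")
  case True
  have "0 \<le> localization_norm k" unfolding localization_norm_def by (rule infsum_nonneg) auto
  with True show ?thesis by simp
next
  case False
  have "\<exists>v. coord v 0 = 1 \<and> mathieu \<alpha> \<beta> \<theta> v = E *\<^sub>R v \<and> (norm v)\<^sup>2 \<le> localization_norm k" if "E \<in> A" for E
  proof -
    obtain \<xi> where \<xi>: "localized \<alpha> \<beta> k E \<theta> \<xi>" using assms(2) \<open>E \<in> A\<close> by blast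
    show ?thesis by (rule localized_vector[OF \<xi>]) (use \<xi> in \<open>auto simp: localized_def\<close>)
  qed
  then obtain v where v: "\<And>E. E \<in> A \<Longrightarrow> coord (v E) 0 = 1" "\<And>E. E \<in> A \<Longrightarrow> mathieu \<alpha> \<beta> \<theta> (v E) = E *\<^sub>R v E"
    "\<And>E. E \<in> A \<Longrightarrow> (norm (v E))\<^sup>2 \<le> localization_norm k"
    by metis
  have orth: "v E \<bullet> v F = 0" if "E \<in> A" "F \<in> A" "E \<noteq> F" for E F
  proof -
    have "E * (v E \<bullet> v F) = F * (v E \<bullet> v F)"
      using mathieu_symmetric[of \<alpha> \<beta> \<theta> "v E" "v F"] v(2)[OF that(1)] v(2)[OF that(2)] by simp
    then show ?thesis using that(3) by simp
  qed
  \<comment> \<open>All eigenvectors are 1 at the site 0, so this coordinate of the sum counts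
    \<open>A\<close>, while by orthogonality the squared norm grows only linearly in the
    count.\<close>
  define u where "u = (\<Sum>E\<in>A. v E)"
  have "real (card A) = coord u 0" using v(1) by (simp add: u_def)
  then have "(real (card A))\<^sup>2 \<le> (norm u)\<^sup>2"
    using abs_coord_le_norm[of u 0] by (simp add: power_mono)
  also have "\<dots> = (\<Sum>E\<in>A. (norm (v E))\<^sup>2)"
    unfolding u_def by (rule norm_sum_Pythagorean[OF assms(1)])
      (use orth in \<open>auto simp: pairwise_def orthogonal_def\<close>)
  also have "\<dots> \<le> real (card A) * localization_norm k"
    using sum_bounded_above[of A "\<lambda>E. (norm (v E))\<^sup>2"] v(3) by simp
  finally show ?thesis
    using False assms(1) by (simp add: power2_eq_square card_gt_0_iff)
qed

section \<open>Closed classes of energies and the Baire argument\<close>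

definition uniformly_localized :: "real \<Rightarrow> real \<Rightarrow> nat \<Rightarrow> real set" where
  "uniformly_localized \<alpha> \<beta> k = {E. \<exists>\<theta>\<in>{0..2 * pi}. \<exists>\<xi>. localized \<alpha> \<beta> k E \<theta> \<xi>}"

text \<open>The exponential envelope confines eigenvectors to a product of compact intervals,
  compact by Tychonoff, and the phases form a compact interval. For bounded energies the class is
  then a projection of a compact set; closedness is local, so bounded pieces suffice.\<close>

lemma closed_uniformly_localized: "closed (uniformly_localized \<alpha> \<beta> k)"
proof -
  define B where "B = {\<xi> :: int \<Rightarrow> real. \<forall>n. \<bar>\<xi> n\<bar> \<le> k * exp (- \<bar>real_of_int n\<bar> / k)}"
  have "compactin (product_topology (\<lambda>_. euclidean) UNIV)
      (PiE UNIV (\<lambda>n::int. {- (k * exp (- \<bar>real_of_int n\<bar> / k))..k * exp (- \<bar>real_of_int n\<bar> / k)}))"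
    by (subst compactin_PiE) (auto simp: compactin_euclidean_iff)
  moreover have "PiE UNIV (\<lambda>n::int. {- (k * exp (- \<bar>real_of_int n\<bar> / k))..k * exp (- \<bar>real_of_int n\<bar> / k)}) = B"
    by (auto simp: B_def PiE_def Pi_def abs_le_iff minus_le_iff)
  ultimately have "compact B"
    by (simp add: euclidean_product_topology compactin_euclidean_iff)
  \<comment> \<open>Each equation involves finitely many coordinates, so it is a closed condition in
    the product topology; the value 1 at the site 0 also survives limits.\<close>
  define P where "P = {p :: real \<times> real \<times> (int \<Rightarrow> real). snd (snd p) 0 = 1} \<inter>
    (\<Inter>n. {p. snd (snd p) (n + 1) + snd (snd p) (n - 1)
       + 2 * \<beta> * cos (2 * pi * \<alpha> * of_int n + fst (snd p)) * snd (snd p) n = fst p * snd (snd p) n})"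
  have c: "continuous_on UNIV (\<lambda>p :: real \<times> real \<times> (int \<Rightarrow> real). snd (snd p) n)" for n
    by (rule continuous_on_compose2[of UNIV "\<lambda>\<xi>. \<xi> n" UNIV "\<lambda>p. snd (snd p)"])
      (intro continuous_on_product_coordinates continuous_intros | simp)+
  have "closed P"
    unfolding P_def
    by (intro closed_Int closed_INT ballI closed_Collect_eq continuous_intros c)
  have *: "uniformly_localized \<alpha> \<beta> k \<inter> cball 0 r = fst ` ((cball 0 r \<times> {0..2 * pi} \<times> B) \<inter> P)" for r
    by (force simp: uniformly_localized_def localized_def solves_def P_def B_def image_iff)
  have "compact (uniformly_localized \<alpha> \<beta> k \<inter> cball 0 r)" for r
    unfolding *
    by (intro compact_continuous_image continuous_on_fst continuous_on_id compact_Int_closed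
        compact_Times compact_cball compact_Icc \<open>compact B\<close> \<open>closed P\<close>)
  then have "closed (uniformly_localized \<alpha> \<beta> k \<inter> cball 0 r)" for r
    by (rule compact_imp_closed)
  note closed_cball = this
  have "l \<in> uniformly_localized \<alpha> \<beta> k" if l: "l \<in> closure (uniformly_localized \<alpha> \<beta> k)" for l
  proof -
    have "l \<in> ball l 1 \<inter> closure (uniformly_localized \<alpha> \<beta> k)" using l by simp
    then have "l \<in> closure (ball l 1 \<inter> uniformly_localized \<alpha> \<beta> k)"
      using open_Int_closure_subset[OF open_ball] by blast
    also have "ball l 1 \<inter> uniformly_localized \<alpha> \<beta> k \<subseteq> uniformly_localized \<alpha> \<beta> k \<inter> cball 0 (\<bar>l\<bar> + 1)"
      by (auto simp: dist_real_def)
    then have "closure (ball l 1 \<inter> uniformly_localized \<alpha> \<beta> k) \<subseteq> uniformly_localized \<alpha> \<beta> k \<inter> cball 0 (\<bar>l\<bar> + 1)"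
      by (rule closure_minimal) (rule closed_cball)
    finally show ?thesis by blast
  qed
  then show ?thesis using closure_subset_eq by blast
qed

text \<open>Empty interior puts a point \<open>z\<close> outside \<open>S\<close> close to
  \<open>x\<close>; the point of \<open>S\<close> between them nearest to \<open>z\<close> borders a
  gap.\<close>

lemma gap_edge_near:
  fixes S :: "real set"
  assumes "closed S" "interior S = {}" "x \<in> S" "r > 0"
  obtains y e where "y \<in> S" "\<bar>y - x\<bar> < r" "e > 0" "{y<..<y + e} \<inter> S = {} \<or> {y - e<..<y} \<inter> S = {}"
proof -
  have "\<not> ball x r \<subseteq> S" using assms(2,4) by (metis centre_in_ball empty_iff interior_maximal open_ball subsetD)
  then obtain z where "z \<in> ball x r" "z \<notin> S" by blast
  then have z: "\<bar>z - x\<bar> < r" "z \<notin> S" by (auto simp: dist_real_def abs_minus_commute)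
  consider "z < x" | "x < z" using z(2) assms(3) by fastforce
  then show ?thesis
  proof cases
    case 1
    define y where "y = Inf (S \<inter> {z..x})"
    have ne: "S \<inter> {z..x} \<noteq> {}" "bdd_below (S \<inter> {z..x})" using assms(3) 1 by auto
    have "y \<in> S \<inter> {z..x}"
      unfolding y_def by (rule closed_contains_Inf[OF ne]) (intro closed_Int assms(1) closed_atLeastAtMost)
    then have y: "y \<in> S" "z \<le> y" "y \<le> x" by auto
    then have "z < y" using z(2) by (metis less_le)
    have "{z<..<y} \<inter> S = {}"
      using cInf_lower[OF _ ne(2)] y(3) unfolding y_def[symmetric] by fastforce
    then show ?thesis using that[of y "y - z"] y z(1) \<open>z < y\<close> by auto
  next
    case 2
    define y where "y = Sup (S \<inter> {x..z})"
    have ne: "S \<inter> {x..z} \<noteq> {}" "bdd_above (S \<inter> {x..z})" using assms(3) 2 by auto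
    have "y \<in> S \<inter> {x..z}"
      unfolding y_def by (rule closed_contains_Sup[OF ne]) (intro closed_Int assms(1) closed_atLeastAtMost)
    then have y: "y \<in> S" "y \<le> z" "x \<le> y" by auto
    then have "y < z" using z(2) by (metis less_le)
    have "{y<..<z} \<inter> S = {}"
      using cSup_upper[OF _ ne(2)] y(3) unfolding y_def[symmetric] by fastforce
    then show ?thesis using that[of y "z - y"] y z(1) \<open>y < z\<close> by auto
  qed
qed

theorem theorem2:
  fixes \<alpha> \<beta> :: real
  assumes "\<alpha> \<notin> \<rat>"
    and "\<forall>E\<in>Sp \<alpha> \<beta>. \<exists>\<theta>::real. \<exists>\<xi>.
           ell2_eigenvector (almost_mathieu \<alpha> \<beta> \<theta>) (complex_of_real E) \<xi> \<and> decays_exponentially \<xi>"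
  shows "\<not> nowhere_dense (Sp \<alpha> \<beta>)"
proof
  assume nd: "nowhere_dense (Sp \<alpha> \<beta>)"
  have cover: "E \<in> (\<Union>k. uniformly_localized \<alpha> \<beta> k)" if "E \<in> Sp \<alpha> \<beta>" for E
    using assms(2) that exists_localized unfolding uniformly_localized_def by fastforce
  have loc_spec: "E \<in> ap_spec \<alpha> \<beta>" if "localized \<alpha> \<beta> k E \<theta> \<xi>" for k E \<theta> \<xi>
    by (rule localized_vector[OF that]) (rule ap_spec_eigenvalue[OF assms(1)])
  define S where "S = Sp \<alpha> \<beta>"
  \<comment> \<open>The hypothesis makes each point of the spectrum an eigenvalue at some phase,
    hence an approximate eigenvalue at phase 0. Closedness of the spectrum follows from this
    identification.\<close>
  have S: "S = ap_spec \<alpha> \<beta>"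
    using cover loc_spec ap_spec_subset_Sp unfolding S_def uniformly_localized_def by blast
  have "closed S" "S \<noteq> {}" by (simp_all add: S closed_ap_spec ap_spec_nonempty)
  have "interior S = {}" using nd \<open>closed S\<close> by (simp add: nowhere_dense_def S_def[symmetric])
  \<comment> \<open>Baire in complementary form: if the relatively open complements of all classes
    were dense in \<open>S\<close>, so would be their intersection, which is empty because the
    classes cover \<open>S\<close>.\<close>
  have "\<exists>k. \<not> S \<subseteq> closure (S - uniformly_localized \<alpha> \<beta> k)"
  proof (rule ccontr)
    assume "\<not> ?thesis"
    then have "S \<subseteq> closure (\<Inter>(range (\<lambda>k. S - uniformly_localized \<alpha> \<beta> k)))"
      by (intro Baire[OF \<open>closed S\<close>]) (auto simp: Diff_eq intro!: openin_open_Int open_Compl closed_uniformly_localized)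
    moreover have "(\<Inter>(range (\<lambda>k. S - uniformly_localized \<alpha> \<beta> k))) = {}" using cover by (auto simp: S_def)
    ultimately show False using \<open>S \<noteq> {}\<close> by (metis closure_empty subset_empty)
  qed
  then obtain k x where x: "x \<in> S" "x \<notin> closure (S - uniformly_localized \<alpha> \<beta> k)" by blast
  obtain r where "r > 0" "\<forall>y\<in>S - uniformly_localized \<alpha> \<beta> k. \<not> dist y x < r"
    using x(2) unfolding closure_approachable by blast
  then have r: "r > 0" "\<And>y. y \<in> S \<Longrightarrow> \<bar>y - x\<bar> < r \<Longrightarrow> y \<in> uniformly_localized \<alpha> \<beta> k"
    unfolding dist_real_def by blast+
  define edges where "edges = {y \<in> S. \<bar>y - x\<bar> < r \<and>
    (\<exists>e>0. {y<..<y + e} \<inter> S = {} \<or> {y - e<..<y} \<inter> S = {})}"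
  define R where "R = {\<theta> \<in> {0..2 * pi}. \<exists>m d :: int. 2 * \<theta> = 2 * pi * of_int m - 2 * pi * \<alpha> * of_int d
    \<and> \<bar>real_of_int d\<bar> \<le> real k * real k}"
  have "\<exists>\<theta>\<in>R. \<exists>\<xi>. localized \<alpha> \<beta> k y \<theta> \<xi>" if edge: "y \<in> edges" for y
  proof -
    have y: "y \<in> S" "\<bar>y - x\<bar> < r" using edge by (auto simp: edges_def)
    obtain \<theta> \<xi> where \<theta>: "\<theta> \<in> {0..2 * pi}" and l: "localized \<alpha> \<beta> k y \<theta> \<xi>"
      using r(2)[OF y] by (auto simp: uniformly_localized_def)
    obtain e where "e > 0" "{y<..<y + e} \<inter> ap_spec \<alpha> \<beta> = {} \<or> {y - e<..<y} \<inter> ap_spec \<alpha> \<beta> = {}"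
      using edge by (auto simp: edges_def S)
    from localized_resonance_at_gap_edge[OF assms(1) l this] \<theta> l show ?thesis by (auto simp: R_def)
  qed
  then have sub: "edges \<subseteq> (\<Union>\<theta>\<in>R. {y. \<exists>\<xi>. localized \<alpha> \<beta> k y \<theta> \<xi>})" by blast
  have "finite R" unfolding R_def by (rule finite_resonant_phases)
  moreover have "finite {y. \<exists>\<xi>. localized \<alpha> \<beta> k y \<theta> \<xi>}" for \<theta>
  proof (rule ccontr)
    assume "infinite {y. \<exists>\<xi>. localized \<alpha> \<beta> k y \<theta> \<xi>}"
    from infinite_arbitrarily_large[OF this, of "Suc (nat \<lceil>localization_norm k\<rceil>)"]
    obtain A where A: "finite A" "card A = Suc (nat \<lceil>localization_norm k\<rceil>)"
      "A \<subseteq> {y. \<exists>\<xi>. localized \<alpha> \<beta> k y \<theta> \<xi>}"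
      by blast
    moreover have "real (card A) \<le> localization_norm k"
      by (rule finite_localized_energies[OF A(1)]) (use A(3) in blast)
    ultimately show False by linarith
  qed
  ultimately have "finite edges" by (intro finite_subset[OF sub] finite_UN_I)
  \<comment> \<open>The extra element \<open>r - \<bar>y - x\<bar>\<close> keeps the neighbourhood
    of \<open>y\<close> inside the window around \<open>x\<close> and makes the minimum exist even
    when there are no other edges.\<close>
  have "\<exists>d>0. d \<le> r - \<bar>y - x\<bar> \<and> (\<forall>z\<in>edges. z \<noteq> y \<longrightarrow> d \<le> \<bar>z - y\<bar>)" if "\<bar>y - x\<bar> < r" for y
  proof -
    have "finite (insert (r - \<bar>y - x\<bar>) ((\<lambda>z. \<bar>z - y\<bar>) ` (edges - {y})))" using \<open>finite edges\<close> by simp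
    then show ?thesis
      using that by (intro exI[of _ "Min (insert (r - \<bar>y - x\<bar>) ((\<lambda>z. \<bar>z - y\<bar>) ` (edges - {y})))"]) auto
  qed
  note separated = this
  \<comment> \<open>A point of the spectrum that is not an edge: since \<open>x\<close> is not
    isolated, some spectral point other than \<open>x\<close> lies closer to it than every edge
    different from \<open>x\<close>.\<close>
  obtain y where y: "y \<in> S" "y \<notin> edges" "\<bar>y - x\<bar> < r"
  proof -
    obtain d where d: "d > 0" "d \<le> r" "\<And>z. z \<in> edges \<Longrightarrow> z \<noteq> x \<Longrightarrow> d \<le> \<bar>z - x\<bar>"
      using separated[of x] r(1) by auto
    obtain \<theta> \<xi> where "localized \<alpha> \<beta> k x \<theta> \<xi>"
      using r(2)[OF x(1)] r(1) by (auto simp: uniformly_localized_def)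
    from localized_not_isolated[OF assms(1) this d(1)]
    obtain F where F: "F \<in> S" "F \<noteq> x" "\<bar>F - x\<bar> < d" by (auto simp: S)
    with d show ?thesis using that[of F] by force
  qed
  obtain d where d: "d > 0" "d \<le> r - \<bar>y - x\<bar>" "\<And>z. z \<in> edges \<Longrightarrow> z \<noteq> y \<Longrightarrow> d \<le> \<bar>z - y\<bar>"
    using separated[OF y(3)] by auto
  \<comment> \<open>A gap edge arbitrarily near \<open>y\<close> must be in \<open>edges\<close> and
    differ from \<open>y\<close>, against the positive distance \<open>d\<close>.\<close>
  obtain z e where z: "z \<in> S" "\<bar>z - y\<bar> < d" "e > 0" "{z<..<z + e} \<inter> S = {} \<or> {z - e<..<z} \<inter> S = {}"
    by (rule gap_edge_near[OF \<open>closed S\<close> \<open>interior S = {}\<close> y(1) d(1)])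
  have "\<bar>z - x\<bar> < r" using z(2) d(2) by linarith
  with z have "z \<in> edges" unfolding edges_def by blast
  with y(2) d(3)[of z] z(2) show False by force
qed

end
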